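(* Let $\mathbb{K}=\mathbb{R}$ or $\mathbb{K}=\mathbb{C}$ and let $d\ge3$. There are no 3-reflective local $\mathbb{K}$-analytic projective billiards in $\mathbb{K}^d$.
   Context: $\mathbb{P}(T\mathbb{K}^d)$ is the set of pairs $(A,L)$ with $A\in\mathbb{K}^d$ and $L$ a ($\mathbb{K}$-)line through $A$ (identified with a 1-dimensional subspace of $T_A\mathbb{K}^d$); $\pi(A,L)=A$. A $\mathbb{K}$-analytic line-framed hypersurface is a regularly embedded connected $\mathbb{K}$-analytic $(d-1)$-dimensional submanifold $\alpha\subset\mathbb{P}(T\mathbb{K}^d)$ such that $\pi$ sends $\alpha$ diffeomorphically (biholomorphically if $\mathbb{K}=\mathbb{C}$) onto a regularly embedded hypersurface $a\subset\mathbb{K}^d$ (its classical boundary), and for every $(A,L)\in\alpha$ the line $L$ is transversal to $T_Aa$. A $\mathbb{K}$-analytic local projective billiard is a collection of germs of such hypersurfaces $\alpha_1,\dots,\alpha_k$, with classical boundaries $a_1,\dots,a_k$. Symmetry of lines: let $(A,L)\in\alpha$, with classical boundary $a$. Two lines $\ell,\ell^*$ through $A$ are symmetric with respect to $(L,T_Aa)$ if $\ell,\ell^*,L$ lie in a common 2-dimensional subspace $\Pi\subset T_A\mathbb{K}^d$ and, with $T=\Pi\cap T_Aa$, either $\ell=\ell^*=L$, or $\ell=\ell^*=T$, or $L,T,\ell,\ell^*$ are distinct and harmonic, i.e. the cross-ratio $(L,T;\ell,\ell^* )$ of these four lines of $\Pi$ equals $-1$ (equivalently, $\ell,\ell^*$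 are exchanged by the linear involution of $\Pi$ that is the identity on $L$ and minus the identity on $T$). A $k$-periodic orbit of a local projective billiard is a $k$-tuple $(A_1,L_1),\dots,(A_k,L_k)$, $(A_j,L_j)\in\alpha_j$, such that for every $j=1,\dots,k$ (indices cyclic) $A_j\ne A_{j\pm1}$, and the lines $A_{j-1}A_j$, $A_jA_{j+1}$ are not tangent to $a_j$ at $A_j$ and are symmetric with respect to $(L_j,T_{A_j}a_j)$. The billiard is $k$-reflective if its base points form a $k$-periodic orbit and every pair in $\alpha_1\times\alpha_2$ close to the pair of base points extends to a $k$-periodic orbit close to the base orbit. *)

theory Defs
  imports "HOL-Analysis.Analysis"
begin

text \<open>
  Everything is polymorphic in the ground field \<open>'k\<close>, of class \<open>real_normed_field\<close>; the
  instances used are \<open>'k = real\<close> and \<open>'k = complex\<close>. Subspaces, spans and dimensions over \<open>'k\<close>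
  are those of the interpretation \<open>vec\<close> of \<open>(*s)\<close>, so for \<open>'k = complex\<close> they are the complex ones.
\<close>

subsection \<open>Analytic functions of several variables\<close>

text \<open>Multi-indices are functions \<open>'n \<Rightarrow> nat\<close>. Over the complex field this is holomorphy.\<close>

definition multi_analytic_at :: "('k::real_normed_field ^ 'n \<Rightarrow> 'k) \<Rightarrow> 'k ^ 'n \<Rightarrow> bool" where
  "multi_analytic_at f p \<longleftrightarrow>
     (\<exists>(c :: ('n \<Rightarrow> nat) \<Rightarrow> 'k) r. r > 0 \<and>
        (\<forall>x\<in>ball p r. ((\<lambda>\<nu>. c \<nu> * (\<Prod>i\<in>UNIV. (x $ i - p $ i) ^ \<nu> i)) has_sum f x) UNIV))"

definition multi_analytic_on :: "('k::real_normed_field ^ 'n \<Rightarrow> 'k) \<Rightarrow> ('k ^ 'n) set \<Rightarrow> bool" where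
  "multi_analytic_on f U \<longleftrightarrow> (\<forall>p\<in>U. multi_analytic_at f p)"

definition gradient :: "('k::real_normed_field ^ 'n \<Rightarrow> 'k) \<Rightarrow> 'k ^ 'n \<Rightarrow> 'k ^ 'n" where
  "gradient f p = (\<chi> j. deriv (\<lambda>t. f (p + t *s axis j 1)) 0)"

definition independent_gradients ::
    "nat \<Rightarrow> (nat \<Rightarrow> 'k::real_normed_field ^ 'n \<Rightarrow> 'k) \<Rightarrow> 'k ^ 'n \<Rightarrow> bool" where
  "independent_gradients m F p \<longleftrightarrow>
     (\<forall>c. (\<Sum>i<m. c i *s gradient (F i) p) = 0 \<longrightarrow> (\<forall>i<m. c i = 0))"

subsection \<open>Submanifolds of the affine space\<close>

text \<open>
  Regularly embedded analytic submanifolds of dimension \<open>n\<close>: locally the common zero set of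
  (ambient dimension - \<open>n\<close>) analytic functions with linearly independent differentials.
\<close>

definition embedded_submanifold :: "nat \<Rightarrow> ('k::real_normed_field ^ 'n) set \<Rightarrow> bool" where
  "embedded_submanifold n S \<longleftrightarrow>
     (let m = CARD('n) - n in
      \<forall>p\<in>S. \<exists>U F. open U \<and> p \<in> U \<and> (\<forall>i<m. multi_analytic_on (F i) U) \<and>
         independent_gradients m F p \<and> S \<inter> U = {x\<in>U. \<forall>i<m. F i x = 0})"

text \<open>The tangent space, consisting of the velocities of curves with parameter in \<open>'k\<close>.\<close>

definition tangent_space ::
    "('k::real_normed_field ^ 'n) set \<Rightarrow> 'k ^ 'n \<Rightarrow> ('k ^ 'n) set" where
  "tangent_space a A =
     {v. \<exists>\<gamma>. \<gamma> 0 = A \<and> (\<forall>\<^sub>F t in nhds 0. \<gamma> t \<in> a) \<and>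
         (\<forall>i. ((\<lambda>t. \<gamma> t $ i) has_field_derivative v $ i) (at 0))}"

subsection \<open>The projectivized tangent bundle\<close>

text \<open>A line through \<open>A\<close> is represented by its direction, a one-dimensional subspace.\<close>

type_synonym ('k, 'd) framed_point = "('k ^ 'd) \<times> ('k ^ 'd) set"

definition PT :: "('k::real_normed_field, 'd::finite) framed_point set" where
  "PT = {(A, L). vec.subspace L \<and> vec.dim L = 1}"

text \<open>
  \<open>PT\<close> is the quotient of the open set of pairs (point, nonzero vector) by rescaling the
  vector. Such a pair is a single vector \<open>z\<close> indexed by \<open>'d + 'd\<close>, with the point in the
  \<open>Inl\<close> coordinates and the vector in the \<open>Inr\<close> coordinates.
\<close>

definition base_part :: "'k ^ ('d::finite + 'd) \<Rightarrow> 'k ^ 'd" where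
  "base_part z = (\<chi> i. z $ Inl i)"

definition direction_part :: "'k ^ ('d::finite + 'd) \<Rightarrow> 'k ^ 'd" where
  "direction_part z = (\<chi> i. z $ Inr i)"

definition to_PT :: "'k::real_normed_field ^ ('d::finite + 'd) \<Rightarrow> ('k, 'd) framed_point" where
  "to_PT z = (base_part z, vec.span {direction_part z})"

definition PT_lift ::
    "('k::real_normed_field, 'd::finite) framed_point set \<Rightarrow> ('k ^ ('d + 'd)) set" where
  "PT_lift W = {z. direction_part z \<noteq> 0 \<and> to_PT z \<in> W}"

definition PT_topology :: "('k::real_normed_field, 'd::finite) framed_point topology" where
  "PT_topology = topology (\<lambda>W. W \<subseteq> PT \<and> open (PT_lift W))"

lemma openin_PT_topology:
  fixes W :: "('k::real_normed_field, 'd::finite) framed_point set"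
  shows "openin PT_topology W \<longleftrightarrow> W \<subseteq> PT \<and> open (PT_lift W)"
proof -
  have "istopology (\<lambda>W :: ('k, 'd) framed_point set. W \<subseteq> PT \<and> open (PT_lift W))"
    unfolding istopology_def
  proof (intro conjI allI impI)
    fix S T :: "('k, 'd) framed_point set"
    assume *: "S \<subseteq> PT \<and> open (PT_lift S)" "T \<subseteq> PT \<and> open (PT_lift T)"
    have "PT_lift (S \<inter> T) = PT_lift S \<inter> PT_lift T"
      by (auto simp: PT_lift_def)
    then show "open (PT_lift (S \<inter> T))"
      using * by auto
    show "S \<inter> T \<subseteq> PT"
      using * by auto
  next
    fix \<K> :: "('k, 'd) framed_point set set"
    assume *: "\<forall>K\<in>\<K>. K \<subseteq> PT \<and> open (PT_lift K)"
    have "PT_lift (\<Union>\<K>) = (\<Union>K\<in>\<K>. PT_lift K)"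
      by (auto simp: PT_lift_def)
    then show "open (PT_lift (\<Union>\<K>))"
      using * by auto
    show "\<Union>\<K> \<subseteq> PT"
      using * by auto
  qed
  then show ?thesis
    by (simp add: PT_topology_def topology_inverse')
qed

text \<open>
  \<open>to_PT\<close> is a surjective submersion, which determines the analytic structure of \<open>PT\<close>: a
  function on an open set \<open>W\<close> of \<open>PT\<close> is analytic iff its composition with \<open>to_PT\<close> is, and
  differentials are independent iff those of the compositions are. \<open>PT\<close> has dimension
  \<open>2 * CARD('d) - 1\<close>.
\<close>

definition embedded_submanifold_PT ::
    "nat \<Rightarrow> ('k::real_normed_field, 'd::finite) framed_point set \<Rightarrow> bool" where
  "embedded_submanifold_PT n S \<longleftrightarrow> S \<subseteq> PT \<and>
     (let m = 2 * CARD('d) - 1 - n in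
      \<forall>p\<in>S. \<exists>W F. openin PT_topology W \<and> p \<in> W \<and>
         (\<forall>i<m. multi_analytic_on (F i \<circ> to_PT) (PT_lift W)) \<and>
         (\<forall>z\<in>PT_lift {p}. independent_gradients m (\<lambda>i. F i \<circ> to_PT) z) \<and>
         S \<inter> W = {x\<in>W. \<forall>i<m. F i x = 0})"

text \<open>
  Analyticity of a map into \<open>PT\<close> from a submanifold \<open>a\<close>: it locally extends to an analytic
  map of an open set of the ambient space, in homogeneous coordinates.
\<close>

definition analytic_map_into_PT ::
    "('k::real_normed_field ^ 'd::finite) set \<Rightarrow> ('k ^ 'd \<Rightarrow> ('k, 'd) framed_point) \<Rightarrow> bool" where
  "analytic_map_into_PT a s \<longleftrightarrow>
     (\<forall>A\<in>a. \<exists>U g. open U \<and> A \<in> U \<and> (\<forall>i. multi_analytic_on (\<lambda>x. g x $ i) U) \<and>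
        (\<forall>x\<in>U. direction_part (g x) \<noteq> 0) \<and> (\<forall>x\<in>a \<inter> U. s x = to_PT (g x)))"

subsection \<open>Line-framed hypersurfaces\<close>

text \<open>
  The projection of the bundle is \<open>fst\<close>, and the classical boundary of \<open>\<alpha>\<close> is \<open>fst ` \<alpha>\<close>. The
  projection is analytic on \<open>\<alpha>\<close> (it is linear in the coordinates \<open>z\<close>), so it is a diffeomorphism
  (biholomorphism) onto its image iff it is injective on \<open>\<alpha>\<close> and its inverse is analytic.
\<close>

definition line_framed_hypersurface ::
    "('k::real_normed_field, 'd::finite) framed_point set \<Rightarrow> bool" where
  "line_framed_hypersurface \<alpha> \<longleftrightarrow>
     embedded_submanifold_PT (CARD('d) - 1) \<alpha> \<and>
     connectedin PT_topology \<alpha> \<and>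
     embedded_submanifold (CARD('d) - 1) (fst ` \<alpha>) \<and>
     inj_on fst \<alpha> \<and>
     analytic_map_into_PT (fst ` \<alpha>) (the_inv_into \<alpha> fst) \<and>
     (\<forall>(A, L)\<in>\<alpha>. {u + v | u v. u \<in> L \<and> v \<in> tangent_space (fst ` \<alpha>) A} = UNIV)"

subsection \<open>Symmetry of lines\<close>

text \<open>
  Four lines of a plane with basis \<open>e\<close>, \<open>f\<close>, spanned by vectors with coordinates \<open>(x i, y i)\<close>,
  have cross-ratio \<open>[1 3][2 4] / ([2 3][1 4])\<close> where \<open>[i j] = x i * y j - x j * y i\<close>. With slopes
  \<open>s i = y i / x i\<close> this is \<open>(s 3 - s 1) (s 4 - s 2) / ((s 3 - s 2) (s 4 - s 1))\<close>. It does not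
  depend on the choices. It is only used for distinct lines.
\<close>

definition has_cross_ratio ::
    "('k::real_normed_field ^ 'd) set \<Rightarrow> ('k ^ 'd) set \<Rightarrow> ('k ^ 'd) set \<Rightarrow> ('k ^ 'd) set \<Rightarrow> 'k \<Rightarrow> bool"
  where
  "has_cross_ratio l1 l2 l3 l4 r \<longleftrightarrow>
     (\<exists>e f x1 y1 x2 y2 x3 y3 x4 y4.
        e \<noteq> f \<and> vec.independent {e, f} \<and>
        l1 = vec.span {x1 *s e + y1 *s f} \<and> l2 = vec.span {x2 *s e + y2 *s f} \<and>
        l3 = vec.span {x3 *s e + y3 *s f} \<and> l4 = vec.span {x4 *s e + y4 *s f} \<and>
        r = ((x1 * y3 - x3 * y1) * (x2 * y4 - x4 * y2)) /
            ((x2 * y3 - x3 * y2) * (x1 * y4 - x4 * y1)))"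

definition symmetric_lines ::
    "('k::real_normed_field ^ 'd) set \<Rightarrow> ('k ^ 'd) set \<Rightarrow> ('k ^ 'd) set \<Rightarrow> ('k ^ 'd) set \<Rightarrow> bool"
  where
  "symmetric_lines L H l l' \<longleftrightarrow>
     (\<exists>P. vec.subspace P \<and> vec.dim P = 2 \<and> l \<subseteq> P \<and> l' \<subseteq> P \<and> L \<subseteq> P \<and>
        (let T = P \<inter> H in
           (l = L \<and> l' = L) \<or> (l = T \<and> l' = T) \<or>
           (distinct [L, T, l, l'] \<and> has_cross_ratio L T l l' (- 1))))"

subsection \<open>Billiards, periodic orbits, reflectivity\<close>

text \<open>
  A billiard with \<open>k\<close> mirrors is given by representatives \<open>\<alpha> j\<close> of its germs together with their
  base points \<open>p j\<close>, for \<open>j < k\<close>, with indices modulo \<open>k\<close>; values at \<open>j \<ge> k\<close> are irrelevant.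
  The notion \<open>k_reflective\<close> depends only on the germs.
\<close>

definition local_projective_billiard ::
    "nat \<Rightarrow> (nat \<Rightarrow> ('k::real_normed_field, 'd::finite) framed_point set) \<Rightarrow>
     (nat \<Rightarrow> ('k, 'd) framed_point) \<Rightarrow> bool" where
  "local_projective_billiard k \<alpha> p \<longleftrightarrow> (\<forall>j<k. line_framed_hypersurface (\<alpha> j) \<and> p j \<in> \<alpha> j)"

definition periodic_orbit ::
    "nat \<Rightarrow> (nat \<Rightarrow> ('k::real_normed_field, 'd::finite) framed_point set) \<Rightarrow>
     (nat \<Rightarrow> ('k, 'd) framed_point) \<Rightarrow> bool" where
  "periodic_orbit k \<alpha> q \<longleftrightarrow>
     (\<forall>j<k. q j \<in> \<alpha> j \<and>
        (let A = fst (q j); L = snd (q j); H = tangent_space (fst ` \<alpha> j) A;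
             A' = fst (q ((j + k - 1) mod k)); A'' = fst (q ((j + 1) mod k))
         in A \<noteq> A' \<and> A \<noteq> A'' \<and>
            A - A' \<notin> H \<and> A'' - A \<notin> H \<and>
            symmetric_lines L H (vec.span {A - A'}) (vec.span {A'' - A})))"

definition k_reflective ::
    "nat \<Rightarrow> (nat \<Rightarrow> ('k::real_normed_field, 'd::finite) framed_point set) \<Rightarrow>
     (nat \<Rightarrow> ('k, 'd) framed_point) \<Rightarrow> bool" where
  "k_reflective k \<alpha> p \<longleftrightarrow>
     periodic_orbit k \<alpha> p \<and>
     (\<forall>W. (\<forall>j<k. openin PT_topology (W j) \<and> p j \<in> W j) \<longrightarrow>
        (\<exists>U0 U1. openin PT_topology U0 \<and> p 0 \<in> U0 \<and> openin PT_topology U1 \<and> p 1 \<in> U1 \<and>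
           (\<forall>q0\<in>\<alpha> 0 \<inter> U0. \<forall>q1\<in>\<alpha> 1 \<inter> U1.
              \<exists>q. periodic_orbit k \<alpha> q \<and> q 0 = q0 \<and> q 1 = q1 \<and> (\<forall>j<k. q j \<in> W j))))"

end

theory Submission
  imports Defs
begin

text \<open>
  In a 3-periodic orbit \<open>ABC\<close> the lines at \<open>A\<close> and \<open>B\<close> lie in a common plane with \<open>AB\<close>. Since this
  holds for all \<open>A\<close>, \<open>B\<close> near the base points and \<open>d \<ge> 3\<close>, all these lines pass through one point \<open>O\<close>,
  possibly at infinity, and then so does the line at \<open>C\<close>. Normalize the conormals \<open>N\<close> of \<open>a\<close> and
  \<open>M\<close> of \<open>b\<close> to take the value \<open>1\<close> on \<open>O - A\<close> and \<open>O - B\<close> (in homogeneous coordinates), and set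
  \<open>\<alpha> = N(B - A)\<close>, \<open>\<beta> = M(A - B)\<close>. Then \<open>C\<close> is an explicit rational function of \<open>A\<close>, \<open>B\<close>, \<open>\<alpha>\<close>, \<open>\<beta>\<close>, and
  the condition that \<open>C\<close> stays on its hypersurface when \<open>A\<close> moves in the plane of the triangle is
  \<open>\<beta> II\<^sub>A(B) = \<alpha>\<^sup>2\<close>, where \<open>II\<^sub>A(B)\<close> is the second fundamental form of \<open>a\<close> at \<open>A\<close> evaluated at the
  projection of \<open>B - A\<close> along the line at \<open>A\<close>. Differentiating this relation in \<open>B\<close>, and using the
  symmetric one, gives \<open>3 \<alpha> \<beta> = 0\<close>, whereas \<open>\<alpha>\<close> and \<open>\<beta>\<close> are nonzero.
\<close>

subsection \<open>Differentiability of analytic functions\<close>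

text \<open>The hypothesis only says that some \<open>C\<close> exists for each \<open>A\<close>,
  \<open>B\<close>; nothing makes it depend smoothly on them. This is why \<open>C\<close> is
  computed: with normalized conormals the reflected sides meet in a point whose formula can be
  differentiated. The third mirror is never parametrized. It enters the curvature computation
  through two facts: the formula for \<open>C\<close> never leaves it, and its conormal at
  \<open>C\<close>, restricted to the plane of the triangle, is forced by the reflection law once
  its line is known to pass through \<open>O\<close>. Hence concurrency has to be extended to
  \<open>C\<close> before any curvature is computed. The dimension is spent on concurrency alone;
  the rest takes place in the plane of one triangle. When \<open>B\<close> moves along the
  projection of \<open>A - B\<close>, the derivatives of the two sides of the relation are \<mu> * 2
  * \<open>\<alpha>\<^sup>2\<close> + \<alpha> * \<beta> and \<mu> * 2 *
  \<open>\<alpha>\<^sup>2\<close> - 2 * \<alpha> * \<beta>, with the same \<mu>; this is the origin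
  of the factor 3.\<close>

lemma summable_on_imp_abs_summable_on:
  fixes f :: "'a \<Rightarrow> 'b::euclidean_space"
  assumes "f summable_on A"
  shows "(\<lambda>x. norm (f x)) summable_on A"
proof (rule Infinite_Sum.abs_summable_on_comparison_test)
  have *: "(\<lambda>x. norm (f x \<bullet> b)) summable_on A" for b
    using summable_on_bounded_linear[OF bounded_linear_inner_left assms]
    by (simp only: summable_on_iff_abs_summable_on_real[symmetric] o_def)
  have "(\<lambda>x. \<Sum>b\<in>B. \<bar>f x \<bullet> b\<bar>) summable_on A" if "finite B" for B
    using that by (induction B rule: finite_induct) (use * in \<open>auto intro: summable_on_add\<close>)
  then show "(\<lambda>x. norm (\<Sum>b\<in>Basis. \<bar>f x \<bullet> b\<bar>)) summable_on A"
    by (simp add: sum_nonneg)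
  show "norm (f x) \<le> norm (\<Sum>b\<in>Basis. \<bar>f x \<bullet> b\<bar>)" for x
    using norm_le_l1[of "f x"] by (simp add: sum_nonneg)
qed

lemma infinite_multi_indices: "infinite (UNIV :: ('n::finite \<Rightarrow> nat) set)"
proof -
  have "inj (\<lambda>k (i::'n). k::nat)"
    by (auto simp: inj_on_def fun_eq_iff)
  then show ?thesis
    by (metis finite_imageD finite_subset infinite_UNIV_nat subset_UNIV)
qed

text \<open>Term-by-term differentiation: absolute convergence at the single point \<open>u\<close>,
  whose coordinates all differ from those of \<open>p\<close> by \<rho>, gives a summable majorant
  \<open>T\<close>, and on the ball of radius \<rho>/2 it dominates every differentiated term up to
  the factor 2/\<rho>. The partial derivatives are power series again, which later gives second
  derivatives.\<close>

lemma multi_analytic_at_has_derivative: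
  fixes f :: "'k::{real_normed_field,euclidean_space} ^ 'n::finite \<Rightarrow> 'k"
  assumes "multi_analytic_at f p"
  shows "\<exists>r>0. \<exists>G. (\<forall>x\<in>ball p r. (f has_derivative (\<lambda>h. \<Sum>j\<in>UNIV. G j x * h $ j)) (at x)) \<and>
           (\<forall>j. multi_analytic_at (G j) p)"
proof -
  obtain c :: "('n \<Rightarrow> nat) \<Rightarrow> 'k" and r where r: "r > 0"
    and sum: "\<And>x. x \<in> ball p r \<Longrightarrow> ((\<lambda>\<nu>. c \<nu> * (\<Prod>i\<in>UNIV. (x $ i - p $ i) ^ \<nu> i)) has_sum f x) UNIV"
    using assms unfolding multi_analytic_at_def by blast
  define \<rho> where "\<rho> = r / (2 * CARD('n))"
  have \<rho>: "\<rho> > 0" using r by (simp add: \<rho>_def)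
  define T where "T \<nu> = norm (c \<nu>) * (\<Prod>i\<in>UNIV. \<rho> ^ \<nu> i)" for \<nu>
  have T0: "T \<nu> \<ge> 0" for \<nu> using \<rho> by (auto simp: T_def intro!: mult_nonneg_nonneg prod_nonneg)
  have T: "T summable_on UNIV"
  proof -
    define u :: "'k ^ 'n" where "u = (\<chi> i. p $ i + of_real \<rho>)"
    have "dist p u \<le> (\<Sum>i\<in>UNIV. norm ((p - u) $ i))"
      unfolding dist_norm norm_vec_def by (rule L2_set_le_sum) auto
    also have "\<dots> = CARD('n) * \<rho>" using \<rho> by (simp add: u_def)
    also have "\<dots> < r" using r by (simp add: \<rho>_def)
    finally have "u \<in> ball p r" by simp
    from summable_on_imp_abs_summable_on[OF has_sum_imp_summable[OF sum[OF this]]]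
    show ?thesis using \<rho> by (simp add: T_def[abs_def] u_def norm_mult norm_power flip: prod_norm)
  qed
  define e :: "nat \<Rightarrow> 'n \<Rightarrow> nat" where "e = from_nat_into UNIV"
  have e: "bij_betw e UNIV UNIV"
    unfolding e_def by (rule bij_betw_from_nat_into) (simp_all add: infinite_multi_indices)
  have Te: "summable (\<lambda>k. T (e k))"
    using T summable_on_reindex_bij_betw[OF e, of T] summable_on_UNIV_nonneg_real_iff[of "\<lambda>k. T (e k)"] T0
    by auto
  \<comment> \<open>For \<open>\<nu> j = 0\<close> the truncated exponent \<open>\<nu> j - 1\<close>
    is harmless, since the factor \<open>of_nat (\<nu> j)\<close> vanishes.\<close>
  define d where "d j \<nu> x = c \<nu> * (of_nat (\<nu> j) * (x $ j - p $ j) ^ (\<nu> j - 1) *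
      (\<Prod>i\<in>UNIV - {j}. (x $ i - p $ i) ^ \<nu> i))" for j \<nu> and x :: "'k ^ 'n"
  define S where "S = ball p (\<rho>/2)"
  have "\<rho>/2 \<le> r"
  proof -
    have c: "real CARD('n) \<ge> 1" by (simp add: Suc_leI)
    have "r * 1 \<le> r * (4 * real CARD('n))" using r c by (intro mult_left_mono; linarith)
    moreover have "\<rho> / 2 * (4 * real CARD('n)) = r" by (simp add: \<rho>_def)
    ultimately have "\<rho> / 2 * (4 * real CARD('n)) \<le> r * (4 * real CARD('n))" by simp
    then show ?thesis using c by (subst (asm) mult_le_cancel_right_pos) linarith+
  qed
  then have S: "S \<subseteq> ball p r" unfolding S_def by auto
  have d: "norm (d j \<nu> x) \<le> 2 / \<rho> * T \<nu>" if x: "x \<in> S" for j \<nu> x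
  proof (cases "\<nu> j")
    case 0
    then show ?thesis using T0[of \<nu>] \<rho> by (simp add: d_def)
  next
    case (Suc m)
    have comp: "norm (x $ i - p $ i) \<le> \<rho>/2" for i
      using x Finite_Cartesian_Product.norm_nth_le[of "x - p" i] by (simp add: S_def dist_norm norm_minus_commute)
    have comp': "norm (x $ i - p $ i) \<le> \<rho>" for i
      using comp[of i] \<rho> by linarith
    have "norm (d j \<nu> x) = norm (c \<nu>) * (real (\<nu> j) * norm (x $ j - p $ j) ^ (\<nu> j - 1) *
      (\<Prod>i\<in>UNIV - {j}. norm (x $ i - p $ i) ^ \<nu> i))"
      by (simp add: d_def norm_mult norm_power flip: prod_norm)
    also have "\<dots> \<le> norm (c \<nu>) * (real (\<nu> j) * (\<rho>/2) ^ (\<nu> j - 1) * (\<Prod>i\<in>UNIV - {j}. \<rho> ^ \<nu> i))"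
      using \<rho> by (intro mult_left_mono mult_mono prod_mono conjI power_mono comp comp')
        (auto intro!: prod_nonneg mult_nonneg_nonneg)
    \<comment> \<open>Using \<rho>/2 instead of \<rho> in the coordinate \<open>j\<close> gains
      powers of 2, which pay for the factor \<open>\<nu> j\<close> through
      \<open>Suc m \<le> 2 ^ Suc m\<close>.\<close>
    also have "\<dots> \<le> norm (c \<nu>) * ((2 / \<rho> * \<rho> ^ \<nu> j) * (\<Prod>i\<in>UNIV - {j}. \<rho> ^ \<nu> i))"
    proof (intro mult_left_mono mult_right_mono)
      have "real (Suc m) \<le> 2 ^ Suc m" using less_exp[of "Suc m"] by (metis of_nat_less_numeral_power_cancel_iff order_less_imp_le)
      then have "real (Suc m) / 2 ^ m \<le> 2" by (simp add: divide_simps)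
      then have "real (Suc m) / 2 ^ m * \<rho> ^ m \<le> 2 * \<rho> ^ m" using \<rho> by (intro mult_right_mono) auto
      then show "real (\<nu> j) * (\<rho>/2) ^ (\<nu> j - 1) \<le> 2 / \<rho> * \<rho> ^ \<nu> j"
        using \<rho> Suc by (simp add: power_divide)
    qed (use \<rho> in \<open>auto intro!: prod_nonneg\<close>)
    also have "\<dots> = 2 / \<rho> * T \<nu>"
      by (simp add: T_def prod.remove[of UNIV j])
    finally show ?thesis .
  qed
  have dsum: "(\<lambda>\<nu>. d j \<nu> x) summable_on UNIV" if "x \<in> S" for j x
  proof (rule abs_summable_summable, rule Infinite_Sum.abs_summable_on_comparison_test)
    show "(\<lambda>\<nu>. norm (2 / \<rho> * T \<nu>)) summable_on UNIV"
      using summable_on_cmult_right[OF T, of "2 / \<rho>"] T0 \<rho> by simp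
    show "norm (d j \<nu> x) \<le> norm (2 / \<rho> * T \<nu>)" for \<nu>
      using d[OF that, of j \<nu>] T0[of \<nu>] \<rho> by simp
  qed
  define G where "G j x = (\<Sum>\<^sub>\<infinity>\<nu>. d j \<nu> x)" for j x
  have G: "((\<lambda>\<nu>. d j \<nu> x) has_sum G j x) UNIV" if "x \<in> S" for j x
    using dsum[OF that] by (simp add: G_def)
  have Ge: "(\<lambda>k. d j (e k) x) sums G j x" if "x \<in> S" for j x
    using has_sum_imp_sums has_sum_reindex_bij_betw[OF e, of "\<lambda>\<nu>. d j \<nu> x"] G[OF that] by auto
  define t where "t \<nu> x = c \<nu> * (\<Prod>i\<in>UNIV. (x $ i - p $ i) ^ \<nu> i)" for \<nu> and x :: "'k ^ 'n"
  have te: "(\<lambda>k. t (e k) x) sums f x" if "x \<in> S" for x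
    using has_sum_imp_sums has_sum_reindex_bij_betw[OF e, of "\<lambda>\<nu>. t \<nu> x"] sum[of x] that S
    unfolding t_def by blast
  have "\<exists>g. \<forall>x\<in>S. (\<lambda>k. t (e k) x) sums (g x) \<and> (g has_derivative (\<lambda>h. \<Sum>j\<in>UNIV. G j x * h $ j)) (at x within S)"
  proof (rule has_derivative_series[where f' = "\<lambda>k x h. \<Sum>j\<in>UNIV. d j (e k) x * h $ j"])
    show "convex S" by (simp add: S_def)
    show "p \<in> S" using \<rho> by (simp add: S_def)
    then show "(\<lambda>k. t (e k) p) sums f p" by (rule te)
    fix k x
    show "(t (e k) has_derivative (\<lambda>h. \<Sum>j\<in>UNIV. d j (e k) x * h $ j)) (at x within S)"
    proof -
      have *: "((\<lambda>x::'k ^ 'n. x $ i - p $ i) has_derivative (\<lambda>h. h $ i)) (at x within S)" for i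
        using has_derivative_diff[OF bounded_linear_imp_has_derivative[OF bounded_linear_vec_nth]
          has_derivative_const, of i "p $ i"] by simp
      show ?thesis
        unfolding t_def[abs_def] d_def
        by (rule has_derivative_eq_rhs[OF has_derivative_mult_right[OF
                has_derivative_prod[OF has_derivative_power[OF *]]]])
          (simp add: sum_distrib_left mult_ac)
    qed
  next
    fix \<epsilon> :: real assume \<epsilon>: "\<epsilon> > 0"
    define K where "K = 2 / \<rho> * CARD('n)"
    have K: "K > 0" using \<rho> by (simp add: K_def)
    have "\<forall>\<^sub>F n in sequentially. norm (\<Sum>k. T (e (k + n))) < \<epsilon> / K"
      using suminf_exist_split[OF _ Te, of "\<epsilon> / K"] \<epsilon> K unfolding eventually_sequentially by auto
    then show "\<forall>\<^sub>F n in sequentially. \<forall>x\<in>S. \<forall>h. norm ((\<Sum>k<n. \<Sum>j\<in>UNIV. d j (e k) x * h $ j) -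
        (\<Sum>j\<in>UNIV. G j x * h $ j)) \<le> \<epsilon> * norm h"
    proof (eventually_elim, intro ballI allI)
      fix n x and h :: "'k ^ 'n" assume n: "norm (\<Sum>k. T (e (k + n))) < \<epsilon> / K" and x: "x \<in> S"
      have tail: "norm (d j (e k) x * h $ j) \<le> 2 / \<rho> * norm h * T (e k)" for j k
      proof -
        have "norm (d j (e k) x * h $ j) \<le> (2 / \<rho> * T (e k)) * norm h"
          unfolding norm_mult using d[OF x] Finite_Cartesian_Product.norm_nth_le[of h j] T0 \<rho> by (intro mult_mono) auto
        then show ?thesis by (simp add: mult_ac)
      qed
      let ?s = "\<lambda>k. \<Sum>j\<in>UNIV. d j (e k) x * h $ j"
      have s: "?s sums (\<Sum>j\<in>UNIV. G j x * h $ j)"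
        by (intro sums_sum sums_mult2 Ge x)
      have ns: "norm (?s k) \<le> K * norm h * T (e k)" for k
      proof -
        have "norm (?s k) \<le> (\<Sum>j\<in>(UNIV::'n set). 2 / \<rho> * norm h * T (e k))"
          by (rule sum_norm_le) (rule tail)
        also have "\<dots> = K * norm h * T (e k)" by (simp add: K_def)
        finally show ?thesis .
      qed
      have "norm ((\<Sum>k<n. ?s k) - (\<Sum>j\<in>UNIV. G j x * h $ j)) = norm (\<Sum>k. ?s (k + n))"
        using suminf_minus_initial_segment[OF sums_summable[OF s], of n] sums_unique[OF s]
        by (simp add: norm_minus_commute)
      also have "\<dots> \<le> (\<Sum>k. K * norm h * T (e (k + n)))"
        by (rule norm_suminf_le[OF ns]) (intro summable_mult summable_ignore_initial_segment Te)
      also have "\<dots> = K * norm h * (\<Sum>k. T (e (k + n)))"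
        by (intro suminf_mult summable_ignore_initial_segment Te)
      also have "\<dots> \<le> K * norm h * (\<epsilon> / K)"
        using n K by (intro mult_left_mono) auto
      also have "\<dots> = \<epsilon> * norm h" using K by simp
      finally show "norm ((\<Sum>k<n. ?s k) - (\<Sum>j\<in>UNIV. G j x * h $ j)) \<le> \<epsilon> * norm h" .
    qed
  qed
  then obtain g where g: "\<And>x. x \<in> S \<Longrightarrow> (\<lambda>k. t (e k) x) sums (g x)"
    and gd: "\<And>x. x \<in> S \<Longrightarrow> (g has_derivative (\<lambda>h. \<Sum>j\<in>UNIV. G j x * h $ j)) (at x within S)"
    by blast
  have fg: "f x = g x" if "x \<in> S" for x
    using g[OF that] te[OF that] sums_unique2 by blast
  have "(f has_derivative (\<lambda>h. \<Sum>j\<in>UNIV. G j x * h $ j)) (at x)" if "x \<in> S" for x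
  proof -
    have "(g has_derivative (\<lambda>h. \<Sum>j\<in>UNIV. G j x * h $ j)) (at x)"
      using gd[OF that] that at_within_open[of x S] by (simp add: S_def)
    then show ?thesis
      by (rule has_derivative_transform_within_open[where s = S])
        (use that fg in \<open>auto simp: S_def\<close>)
  qed
  moreover have "multi_analytic_at (G j) p" for j
    unfolding multi_analytic_at_def
  proof (intro exI conjI ballI)
    show "\<rho> / 2 > 0" using \<rho> by simp
    fix x assume x: "x \<in> ball p (\<rho>/2)"
    \<comment> \<open>The shift \<open>s\<close> undoes the lowering of the exponent of coordinate
      \<open>j\<close>. The multi-indices that it misses have \<open>\<nu> j = 0\<close> and a
      vanishing derivative.\<close>
    define s where "s \<mu> = \<mu>(j := Suc (\<mu> j))" for \<mu> :: "'n \<Rightarrow> nat"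
    have "inj s"
      by (auto simp: inj_def s_def fun_eq_iff)
    have "((\<lambda>\<nu>. d j \<nu> x) has_sum G j x) (range s)"
    proof (rule has_sum_cong_neutral[THEN iffD1, OF _ _ _ G])
      fix \<nu> assume "\<nu> \<in> UNIV - range s"
      then have "\<nu> j = 0"
        by (metis Diff_iff fun_upd_same fun_upd_triv fun_upd_upd not0_implies_Suc rangeI s_def)
      then show "d j \<nu> x = 0" by (simp add: d_def)
    qed (use x in \<open>auto simp: S_def\<close>)
    then have "((\<lambda>\<mu>. d j (s \<mu>) x) has_sum G j x) UNIV"
      using has_sum_reindex[OF \<open>inj s\<close>, of "\<lambda>\<nu>. d j \<nu> x"] by (simp add: o_def)
    moreover have "d j (s \<mu>) x = c (s \<mu>) * of_nat (Suc (\<mu> j)) * (\<Prod>i\<in>UNIV. (x $ i - p $ i) ^ \<mu> i)" for \<mu>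
      by (simp add: d_def s_def prod.remove[of UNIV j])
    ultimately show "((\<lambda>\<mu>. (c (s \<mu>) * of_nat (Suc (\<mu> j))) * (\<Prod>i\<in>UNIV. (x $ i - p $ i) ^ \<mu> i)) has_sum G j x) UNIV"
      by simp
  qed
  ultimately show ?thesis
    using \<rho> by (intro exI[of _ "\<rho>/2"] conjI exI[of _ G]) (auto simp: S_def)
qed

subsection \<open>Planes and velocities of curves over the ground field\<close>

text \<open>Bilinear, without conjugation over the complex numbers, so that a vector represents a
  \<open>'k\<close>-linear form; conormals are encoded this way.\<close>

definition bdot :: "'k::comm_ring_1 ^ 'n::finite \<Rightarrow> 'k ^ 'n \<Rightarrow> 'k" (infixl "\<odot>" 70) where
  "u \<odot> v = (\<Sum>i\<in>UNIV. u $ i * v $ i)"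

lemma bdot_simps [simp]:
  "0 \<odot> v = 0" "u \<odot> 0 = 0"
  "(u + u') \<odot> v = u \<odot> v + u' \<odot> v" "u \<odot> (v + v') = u \<odot> v + u \<odot> v'"
  "(u - u') \<odot> v = u \<odot> v - u' \<odot> v" "u \<odot> (v - v') = u \<odot> v - u \<odot> v'"
  "(- u) \<odot> v = - (u \<odot> v)" "u \<odot> (- v) = - (u \<odot> v)"
  "(c *s u) \<odot> v = c * (u \<odot> v)" "u \<odot> (c *s v) = c * (u \<odot> v)"
  by (simp_all add: bdot_def algebra_simps sum.distrib sum_subtractf sum_negf sum_distrib_left)

lemma bdot_diff_scale: "u \<odot> (v - c *s w) = u \<odot> v - c * (u \<odot> w)"
  by simp

lemma bdot_axis [simp]: "u \<odot> axis i 1 = u $ i"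
  by (simp add: bdot_def axis_def if_distrib cong: if_cong)

lemmas scale_simps = vec.scale_left_distrib vec.scale_right_distrib
  vec.scale_left_diff_distrib vec.scale_right_diff_distrib vec.scale_scale

lemma span_pair: "z \<in> vec.span {x, y :: 'k::field ^ 'n} \<longleftrightarrow> (\<exists>p q. z = p *s x + q *s y)"
  unfolding vec.span_insert[of x] vec.span_singleton
  by (simp add: image_iff diff_eq_eq add.commute)

lemma in_span_scaleD:
  assumes "c *s x \<in> vec.span S" "c \<noteq> (0 :: 'k::field)"
  shows "x \<in> vec.span S"
proof -
  have "(1 / c * c) *s x \<in> vec.span S"
    unfolding vec.scale_scale[symmetric] by (rule vec.span_scale[OF assms(1)])
  with assms(2) show ?thesis by simp
qed

text \<open>Stated for the pair, because independence of the set \<open>{x, y}\<close> would also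
  hold for \<open>x = y \<noteq> 0\<close>.\<close>

definition lin_indep2 :: "'k::field ^ 'n \<Rightarrow> 'k ^ 'n \<Rightarrow> bool" where
  "lin_indep2 x y \<longleftrightarrow> (\<forall>p q. p *s x + q *s y = 0 \<longrightarrow> p = 0 \<and> q = 0)"

lemma lin_indep2_eq:
  assumes "lin_indep2 x y" "p *s x + q *s y = p' *s x + q' *s y"
  shows "p = p'" "q = q'"
proof -
  have "(p - p') *s x + (q - q') *s y = 0"
    using assms(2) by (simp add: scale_simps algebra_simps)
  then have "p - p' = 0 \<and> q - q' = 0"
    using assms(1) unfolding lin_indep2_def by blast
  then show "p = p'" "q = q'" by auto
qed

lemma lin_indep2_nonzero:
  assumes "lin_indep2 x y"
  shows "x \<noteq> 0" "y \<noteq> 0"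
  using assms[unfolded lin_indep2_def, rule_format, of 1 0]
    assms[unfolded lin_indep2_def, rule_format, of 0 1] by auto

lemma lin_indep2_iff_notin_span:
  assumes "y \<noteq> 0"
  shows "lin_indep2 x y \<longleftrightarrow> x \<notin> vec.span {y}"
proof
  assume *: "lin_indep2 x y"
  show "x \<notin> vec.span {y}"
  proof
    assume "x \<in> vec.span {y}"
    then obtain k where "x = k *s y" by (auto simp: vec.span_singleton)
    then have "1 *s x + (- k) *s y = 0" by simp
    with * show False unfolding lin_indep2_def by fastforce
  qed
next
  assume *: "x \<notin> vec.span {y}"
  show "lin_indep2 x y"
    unfolding lin_indep2_def
  proof (intro allI impI)
    fix p q assume pq: "p *s x + q *s y = 0"
    have "p = 0"
    proof (rule ccontr)
      assume "p \<noteq> 0"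
      then have "x = (- q / p) *s y"
        using pq by (simp add: vec_eq_iff divide_simps eq_neg_iff_add_eq_0 mult.commute)
      with * show False unfolding vec.span_singleton by blast
    qed
    with pq assms show "p = 0 \<and> q = 0" by simp
  qed
qed

text \<open>If all minors vanish, then \<open>y $ j *s x = x $ j *s y\<close> for every
  \<open>j\<close>. A nonzero minor makes independence an open condition and is the denominator in
  Cramer's rule.\<close>

lemma lin_indep2_iff_minor:
  "lin_indep2 x y \<longleftrightarrow> (\<exists>i j. x $ i * y $ j - x $ j * y $ i \<noteq> 0)"
proof
  assume *: "lin_indep2 x y"
  show "\<exists>i j. x $ i * y $ j - x $ j * y $ i \<noteq> 0"
  proof (rule ccontr)
    assume "\<not> ?thesis"
    then have "(y $ j) *s x + (- x $ j) *s y = 0" for j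
      by (simp add: vec_eq_iff mult.commute)
    then have "y $ j = 0" for j
      using * unfolding lin_indep2_def by blast
    then show False
      using lin_indep2_nonzero(2)[OF *] by (simp add: vec_eq_iff)
  qed
next
  assume "\<exists>i j. x $ i * y $ j - x $ j * y $ i \<noteq> 0"
  then obtain i j where ij: "x $ i * y $ j - x $ j * y $ i \<noteq> 0" by blast
  show "lin_indep2 x y"
    unfolding lin_indep2_def
  proof (intro allI impI)
    fix p q assume "p *s x + q *s y = 0"
    then have e: "p * x $ i + q * y $ i = 0" "p * x $ j + q * y $ j = 0"
      by (auto simp: vec_eq_iff)
    have "p * (x $ i * y $ j - x $ j * y $ i) = (p * x $ i + q * y $ i) * y $ j - (p * x $ j + q * y $ j) * y $ i"
      "q * (x $ i * y $ j - x $ j * y $ i) = (p * x $ j + q * y $ j) * x $ i - (p * x $ i + q * y $ i) * x $ j"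
      by (simp_all add: algebra_simps)
    then show "p = 0 \<and> q = 0" using e ij by simp
  qed
qed

lemma cramer:
  fixes x y :: "'k::field ^ 'n"
  assumes "z \<in> vec.span {x, y}" "x $ i * y $ j - x $ j * y $ i \<noteq> 0"
  shows "z = ((z $ i * y $ j - z $ j * y $ i) / (x $ i * y $ j - x $ j * y $ i)) *s x +
             ((x $ i * z $ j - x $ j * z $ i) / (x $ i * y $ j - x $ j * y $ i)) *s y"
proof -
  define D where "D = x $ i * y $ j - x $ j * y $ i"
  obtain p q where z: "z = p *s x + q *s y"
    using assms(1) by (auto simp: span_pair)
  have "z $ i * y $ j - z $ j * y $ i = p * D" "x $ i * z $ j - x $ j * z $ i = q * D"
    by (simp_all add: z D_def algebra_simps)
  then show ?thesis
    using assms(2) z unfolding D_def[symmetric] by simp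
qed

text \<open>Every use of dimension at least three goes back to this fact.\<close>

lemma ex_notin_span_pair:
  assumes "CARD('n::finite) \<ge> 3"
  shows "\<exists>u. u \<notin> vec.span {x, y :: 'k::field ^ 'n}"
proof (rule ccontr)
  assume "\<not> ?thesis"
  then have "vec.span {x, y} = UNIV" by blast
  moreover have "vec.dim (vec.span {x, y}) \<le> card {x, y}"
    unfolding vec.dim_span by (rule vec.dim_le_card') simp
  moreover have "card {x, y} \<le> 2"
    by (simp add: card_insert_if)
  ultimately show False
    using assms vec_dim_card[where 'a='k and 'n='n] by simp
qed

section \<open>Curves with parameter in the ground field and their velocities\<close>

definition has_velocity :: "('k::real_normed_field \<Rightarrow> 'k ^ 'n::finite) \<Rightarrow> 'k ^ 'n \<Rightarrow> bool" where
  "has_velocity \<gamma> v \<longleftrightarrow> (\<forall>i. ((\<lambda>t. \<gamma> t $ i) has_field_derivative v $ i) (at 0))"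

named_theorems velocity_intros

lemma has_velocity_const [velocity_intros]: "has_velocity (\<lambda>t. c) 0"
  by (simp add: has_velocity_def)

lemma has_velocity_add [velocity_intros]:
  "has_velocity \<gamma> v \<Longrightarrow> has_velocity \<delta> w \<Longrightarrow> has_velocity (\<lambda>t. \<gamma> t + \<delta> t) (v + w)"
  by (auto simp: has_velocity_def intro!: derivative_eq_intros)

lemma has_velocity_diff [velocity_intros]:
  "has_velocity \<gamma> v \<Longrightarrow> has_velocity \<delta> w \<Longrightarrow> has_velocity (\<lambda>t. \<gamma> t - \<delta> t) (v - w)"
  by (auto simp: has_velocity_def intro!: derivative_eq_intros)

lemma has_velocity_scale [velocity_intros]:
  "(f has_field_derivative f') (at 0) \<Longrightarrow> has_velocity \<gamma> v \<Longrightarrow>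
     has_velocity (\<lambda>t. f t *s \<gamma> t) (f' *s \<gamma> 0 + f 0 *s v)"
  unfolding has_velocity_def
  by (auto intro!: derivative_eq_intros)

lemma has_velocity_bdot [velocity_intros]:
  assumes "has_velocity \<gamma> v" "has_velocity \<delta> w"
  shows "((\<lambda>t. \<gamma> t \<odot> \<delta> t) has_field_derivative v \<odot> \<delta> 0 + \<gamma> 0 \<odot> w) (at 0)"
  unfolding bdot_def sum.distrib[symmetric]
  using assms unfolding has_velocity_def
  by (intro DERIV_sum) (auto intro!: derivative_eq_intros)

lemma has_velocity_matrix [velocity_intros]:
  assumes "has_velocity \<gamma> v"
  shows "has_velocity (\<lambda>t. M *v \<gamma> t) (M *v v)"
  unfolding has_velocity_def matrix_vector_mult_def
  using assms unfolding has_velocity_def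
  by (auto intro!: DERIV_sum DERIV_cmult)

lemma has_velocity_unique: "has_velocity \<gamma> v \<Longrightarrow> has_velocity \<gamma> w \<Longrightarrow> v = w"
  by (auto simp: has_velocity_def vec_eq_iff intro: DERIV_unique)

lemma has_velocity_tendsto: "has_velocity \<gamma> v \<Longrightarrow> (\<gamma> \<longlongrightarrow> \<gamma> 0) (nhds 0)"
  unfolding has_velocity_def
  by (intro vec_tendstoI) (auto simp: tendsto_nhds_iff intro!: DERIV_isCont[unfolded isCont_def])

lemma has_velocity_transform:
  assumes "has_velocity \<gamma> v" "\<forall>\<^sub>F t in nhds 0. \<gamma> t = \<delta> t"
  shows "has_velocity \<delta> v"
  unfolding has_velocity_def
proof
  fix i
  have "\<forall>\<^sub>F t in nhds 0. \<gamma> t $ i = \<delta> t $ i" using assms(2) by eventually_elim simp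
  then show "((\<lambda>t. \<delta> t $ i) has_field_derivative v $ i) (at 0)"
    using assms(1) DERIV_cong_ev[OF refl _ refl, of "\<lambda>t. \<gamma> t $ i" "\<lambda>t. \<delta> t $ i" 0]
    unfolding has_velocity_def by blast
qed

lemma has_derivative_vecI:
  fixes F :: "'a::real_normed_vector \<Rightarrow> 'k::real_normed_field ^ 'n::finite"
  assumes "\<And>i. ((\<lambda>x. F x $ i) has_derivative (\<lambda>h. D h $ i)) (at p)"
  shows "(F has_derivative D) (at p)"
proof -
  have ax: "bounded_linear (\<lambda>c::'k. c *s axis i 1)" for i :: 'n
  proof (rule bounded_linear_intro[of _ 1])
    fix c :: 'k
    have "norm (c *s axis i 1 :: 'k ^ 'n) \<le> (\<Sum>j\<in>UNIV. norm ((c *s axis i 1 :: 'k ^ 'n) $ j))"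
      unfolding norm_vec_def by (rule L2_set_le_sum) simp
    also have "\<dots> = (\<Sum>j\<in>UNIV. if j = i then norm c else 0)"
      by (rule sum.cong) (auto simp: axis_def)
    finally show "norm (c *s axis i 1 :: 'k ^ 'n) \<le> norm c * 1" by simp
  qed (simp_all add: vec_eq_iff algebra_simps)
  have "((\<lambda>x. \<Sum>i\<in>UNIV. F x $ i *s axis i 1) has_derivative (\<lambda>h. \<Sum>i\<in>UNIV. D h $ i *s axis i 1)) (at p)"
    by (intro has_derivative_sum bounded_linear.has_derivative[OF ax] assms)
  then show ?thesis unfolding basis_expansion .
qed

lemma has_velocity_has_derivative:
  assumes "has_velocity \<gamma> v"
  shows "(\<gamma> has_derivative (\<lambda>s. s *s v)) (at 0)"
  using assms unfolding has_velocity_def has_field_derivative_def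
  by (intro has_derivative_vecI) (simp add: mult.commute[of _ "v $ _"] fun_eq_iff)

text \<open>\<open>has_derivative\<close> is differentiability over the reals; that the derivative
  is a matrix over \<open>'k\<close> turns it into differentiability over \<open>'k\<close> along
  curves.\<close>

lemma has_velocity_compose:
  assumes "(F has_derivative (*v) J) (at A)" "\<gamma> 0 = A" "has_velocity \<gamma> v"
  shows "has_velocity (\<lambda>t. F (\<gamma> t)) (J *v v)"
  unfolding has_velocity_def
proof
  fix i
  have "((\<lambda>t. F (\<gamma> t)) has_derivative (\<lambda>s. J *v (s *s v))) (at 0)"
    using has_derivative_compose[OF has_velocity_has_derivative[OF assms(3)]] assms(1,2) by simp
  from bounded_linear.has_derivative[OF bounded_linear_vec_nth this]
  show "((\<lambda>t. F (\<gamma> t) $ i) has_field_derivative (J *v v) $ i) (at 0)"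
    unfolding has_field_derivative_def
    by (rule has_derivative_eq_rhs) (simp add: vec.scale mult.commute fun_eq_iff)
qed

text \<open>Near \<open>0\<close> the coefficients of \<open>z\<close> with respect to \<open>x\<close>, \<open>y\<close> are differentiable, by Cramer's rule.\<close>

lemma velocity_in_span:
  assumes x: "has_velocity x x'" and y: "has_velocity y y'" and z: "has_velocity z z'"
    and in_span: "\<forall>\<^sub>F t in nhds 0. z t \<in> vec.span {x t, y t}"
    and indep: "lin_indep2 (x 0) (y 0)" and z0: "z 0 = p *s x 0 + q *s y 0"
  shows "z' - p *s x' - q *s y' \<in> vec.span {x 0, y 0}"
proof -
  obtain i j where ij: "x 0 $ i * y 0 $ j - x 0 $ j * y 0 $ i \<noteq> 0"
    using indep unfolding lin_indep2_iff_minor by blast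
  define D where "D t = x t $ i * y t $ j - x t $ j * y t $ i" for t
  define P where "P t = (z t $ i * y t $ j - z t $ j * y t $ i) / D t" for t
  define Q where "Q t = (x t $ i * z t $ j - x t $ j * z t $ i) / D t" for t
  have D0: "D 0 \<noteq> 0" using ij by (simp add: D_def)
  have P0: "P 0 = p" "Q 0 = q"
    using D0 by (simp_all add: P_def Q_def z0 divide_simps) (simp_all add: D_def algebra_simps)
  note c = x[unfolded has_velocity_def, rule_format] y[unfolded has_velocity_def, rule_format]
    z[unfolded has_velocity_def, rule_format]
  have "\<exists>d. (D has_field_derivative d) (at 0)"
    unfolding D_def[abs_def] by (rule exI) (rule derivative_eq_intros c refl)+
  then obtain d where D: "(D has_field_derivative d) (at 0)" by blast
  have "\<exists>d. (P has_field_derivative d) (at 0)" "\<exists>d. (Q has_field_derivative d) (at 0)"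
    unfolding P_def[abs_def] Q_def[abs_def] by (rule exI, (rule derivative_eq_intros c D D0 refl)+)+
  then obtain P' Q' where PQ: "(P has_field_derivative P') (at 0)" "(Q has_field_derivative Q') (at 0)"
    by blast
  have "\<forall>\<^sub>F t in nhds 0. D t \<noteq> 0"
    using DERIV_isCont[OF D] D0 tendsto_imp_eventually_ne[of D "D 0" "nhds 0" 0]
    by (simp add: isCont_def tendsto_nhds_iff)
  with in_span have "\<forall>\<^sub>F t in nhds 0. P t *s x t + Q t *s y t = z t"
  proof eventually_elim
    case (elim t)
    show ?case
      unfolding P_def Q_def D_def
      by (rule cramer[OF elim(1) elim(2)[unfolded D_def], symmetric])
  qed
  then have "has_velocity z (P' *s x 0 + P 0 *s x' + (Q' *s y 0 + Q 0 *s y'))"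
    by (rule has_velocity_transform[rotated]) (intro velocity_intros PQ x y)
  from has_velocity_unique[OF z this]
  have "z' = P' *s x 0 + p *s x' + (Q' *s y 0 + q *s y')"
    unfolding P0 .
  then have "z' - p *s x' - q *s y' = P' *s x 0 + Q' *s y 0" by simp
  then show ?thesis by (auto simp: span_pair)
qed

subsection \<open>Concurrency of the lines\<close>

text \<open>Cramer's rule with one fixed nonzero minor describes the plane by equations that are
  continuous in \<open>z\<close>.\<close>

lemma closed_span_pair:
  fixes x y :: "'k::real_normed_field ^ 'n::finite"
  assumes "lin_indep2 x y"
  shows "closed (vec.span {x, y})"
proof -
  obtain i j where ij: "x $ i * y $ j - x $ j * y $ i \<noteq> 0"
    using assms unfolding lin_indep2_iff_minor by blast
  define D where "D = x $ i * y $ j - x $ j * y $ i"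
  define P where "P z = (z $ i * y $ j - z $ j * y $ i) / D" for z :: "'k ^ 'n"
  define Q where "Q z = (x $ i * z $ j - x $ j * z $ i) / D" for z :: "'k ^ 'n"
  have "z \<in> vec.span {x, y} \<longleftrightarrow> (\<forall>k. z $ k = P z * x $ k + Q z * y $ k)" for z
  proof
    assume "z \<in> vec.span {x, y}"
    from cramer[OF this ij] have "z = P z *s x + Q z *s y"
      unfolding P_def Q_def D_def .
    then have "z $ k = (P z *s x + Q z *s y) $ k" for k by (rule arg_cong)
    then show "\<forall>k. z $ k = P z * x $ k + Q z * y $ k"
      unfolding vector_add_component vector_smult_component by blast
  next
    assume "\<forall>k. z $ k = P z * x $ k + Q z * y $ k"
    then have "z = P z *s x + Q z *s y" by (simp add: vec_eq_iff)
    then show "z \<in> vec.span {x, y}" unfolding span_pair by blast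
  qed
  then have "vec.span {x, y} = (\<Inter>k. {z. z $ k = P z * x $ k + Q z * y $ k})"
    by (simp add: set_eq_iff)
  moreover have "continuous_on UNIV P" "continuous_on UNIV Q"
    using ij unfolding P_def Q_def D_def by (auto intro!: continuous_intros)
  then have "closed {z. z $ k = P z * x $ k + Q z * y $ k}" for k
    by (intro closed_Collect_eq continuous_on_mult continuous_on_add continuous_on_const) (auto intro!: continuous_intros)
  ultimately show ?thesis by auto
qed

section \<open>Tangent spaces and framed patches of hypersurfaces\<close>

lemma tangent_space_eq_velocities:
  "tangent_space a A = {v. \<exists>\<gamma>. \<gamma> 0 = A \<and> (\<forall>\<^sub>F t in nhds 0. \<gamma> t \<in> a) \<and> has_velocity \<gamma> v}"
  by (simp add: tangent_space_def has_velocity_def)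

lemma tangent_space_Int_open:
  assumes "open U" "A \<in> U"
  shows "tangent_space (a \<inter> U) A = tangent_space a A"
proof -
  have "\<forall>\<^sub>F t in nhds 0. \<gamma> t \<in> U" if "\<gamma> 0 = A" "has_velocity \<gamma> v" for \<gamma> v
    using has_velocity_tendsto[OF that(2)] assms that(1) topological_tendstoD by blast
  then show ?thesis
    unfolding tangent_space_eq_velocities by (auto simp: eventually_conj_iff)
qed

text \<open>\<open>N\<close> is a conormal field and \<open>l\<close> spans the field of lines. Both
  are functions on the ambient space, so that their derivatives are plain matrices, but conditions
  are imposed at points of \<open>a\<close> only. The derivative of \<open>N\<close> carries the
  second fundamental form.\<close>

definition framed_patch ::
    "('k::real_normed_field ^ 'n::finite) set \<Rightarrow> ('k ^ 'n \<Rightarrow> 'k ^ 'n) \<Rightarrow> ('k ^ 'n \<Rightarrow> 'k ^ 'n) \<Rightarrow> bool" where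
  "framed_patch a N l \<longleftrightarrow> (\<forall>A\<in>a. tangent_space a A = {v. N A \<odot> v = 0} \<and> N A \<odot> l A \<noteq> 0 \<and>
     (\<exists>J. (N has_derivative (*v) J) (at A)) \<and> (\<exists>K. (l has_derivative (*v) K) (at A)))"

lemma framed_patch_Int_open: "framed_patch a N l \<Longrightarrow> open U \<Longrightarrow> framed_patch (a \<inter> U) N l"
  unfolding framed_patch_def by (auto simp: tangent_space_Int_open)

lemma framed_patch_curve:
  assumes "framed_patch a N l" "A \<in> a" "N A \<odot> v = 0"
  obtains \<gamma> where "\<gamma> 0 = A" "\<forall>\<^sub>F t in nhds 0. \<gamma> t \<in> a" "has_velocity \<gamma> v"
  using assms unfolding framed_patch_def tangent_space_eq_velocities by blast

text \<open>Otherwise the plane would contain all velocities of curves in \<open>b\<close> through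
  \<open>B\<close>, and also \<open>B - A\<close>, which is transversal to \<open>b\<close>;
  together these span the whole space.\<close>

lemma framed_patch_ex_notin_span:
  fixes b :: "('k::real_normed_field ^ 'n::finite) set"
  assumes card: "CARD('n) \<ge> 3" and b: "framed_patch b N l" and B: "B \<in> b" "N B \<odot> (B - A) \<noteq> 0"
    and V: "open V" "B \<in> V" and xy: "lin_indep2 x y"
  shows "\<exists>B'\<in>b \<inter> V. B' - A \<notin> vec.span {x, y}"
proof (rule ccontr)
  assume "\<not> ?thesis"
  then have all: "B' - A \<in> vec.span {x, y}" if "B' \<in> b \<inter> V" for B'
    using that by blast
  obtain u where u: "u \<notin> vec.span {x, y}"
    using ex_notin_span_pair[OF card] by blast
  \<comment> \<open>This \<open>c\<close> makes \<open>u - c *s (B - A)\<close> tangent to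
    \<open>b\<close> at \<open>B\<close>.\<close>
  define c where "c = (N B \<odot> u) / (N B \<odot> (B - A))"
  have "N B \<odot> (u - c *s (B - A)) = 0"
    unfolding bdot_diff_scale using B(2) by (simp del: bdot_simps add: c_def)
  from framed_patch_curve[OF framed_patch_Int_open[OF b V(1)] _ this] B(1) V(2)
  obtain \<gamma> where \<gamma>: "\<gamma> 0 = B" "\<forall>\<^sub>F t in nhds 0. \<gamma> t \<in> b \<inter> V" "has_velocity \<gamma> (u - c *s (B - A))"
    by blast
  have BA: "B - A \<in> vec.span {x, y}" using all B(1) V(2) by blast
  then obtain p q where pq: "B - A = p *s x + q *s y" unfolding span_pair by blast
  have "(u - c *s (B - A) - 0) - p *s 0 - q *s 0 \<in> vec.span {x, y}"
  proof (rule velocity_in_span[where x = "\<lambda>t. x" and y = "\<lambda>t. y" and z = "\<lambda>t. \<gamma> t - A"])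
    show "\<forall>\<^sub>F t in nhds 0. \<gamma> t - A \<in> vec.span {x, y}"
      using \<gamma>(2) by eventually_elim (rule all)
    show "has_velocity (\<lambda>t. \<gamma> t - A) (u - c *s (B - A) - 0)"
      by (intro velocity_intros \<gamma>)
    show "\<gamma> 0 - A = p *s x + q *s y" using \<gamma>(1) pq by simp
  qed (intro velocity_intros xy)+
  from vec.span_add[OF this vec.span_scale[OF BA, of c]] u show False by simp
qed

text \<open>Planes are closed, so once the first is left, a small further move leaves the second
  without returning to the first.\<close>

lemma framed_patch_ex_notin_two_spans:
  fixes b :: "('k::real_normed_field ^ 'n::finite) set"
  assumes card: "CARD('n) \<ge> 3" and b: "framed_patch b N l" "b \<noteq> {}"
    and nt: "\<And>B. B \<in> b \<Longrightarrow> N B \<odot> (B - A) \<noteq> 0"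
    and xy: "lin_indep2 x y" "lin_indep2 x' y'"
  shows "\<exists>B\<in>b. B - A \<notin> vec.span {x, y} \<and> B - A \<notin> vec.span {x', y'}"
proof -
  obtain B where B: "B \<in> b" "B - A \<notin> vec.span {x, y}"
    using framed_patch_ex_notin_span[OF card b(1) _ _ open_UNIV _ xy(1)] b(2) nt by blast
  have "open ((\<lambda>B. B - A) -` (- vec.span {x, y}))"
    using closed_span_pair[OF xy(1)] by (intro open_vimage continuous_intros) auto
  from framed_patch_ex_notin_span[OF card b(1) B(1) nt[OF B(1)] this _ xy(2)] B(2)
  show ?thesis by auto
qed

text \<open>
  The pair \<open>(q, m)\<close> holds homogeneous coordinates of the common point of the lines: they are
  concurrent at \<open>q / m\<close> if \<open>m \<noteq> 0\<close> and parallel to \<open>q\<close> if \<open>m = 0\<close>. For fixed \<open>A\<close>, differentiating the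
  coplanarity with the line at \<open>B\<close> along \<open>v\<close> tangent to \<open>a\<close> shows that the derivative of \<open>l\<close> maps \<open>v\<close>
  to \<open>\<kappa> v\<close> modulo \<open>B - A\<close> and \<open>l A\<close>. Comparing three points \<open>B\<close> shows that \<open>\<kappa>\<close> does not depend on \<open>B\<close>.
\<close>

lemma concurrent_frames:
  fixes a b :: "('k::real_normed_field ^ 'n::finite) set"
  assumes card: "CARD('n) \<ge> 3"
    and a: "framed_patch a N l" "a \<noteq> {}" and b: "framed_patch b M r" "b \<noteq> {}"
    and nt: "\<And>A B. A \<in> a \<Longrightarrow> B \<in> b \<Longrightarrow> M B \<odot> (B - A) \<noteq> 0"
    and coplanar: "\<And>A B. A \<in> a \<Longrightarrow> B \<in> b \<Longrightarrow> \<exists>s \<kappa>. s \<noteq> 0 \<and> r B = s *s (l A + \<kappa> *s (B - A))"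
  shows "\<exists>q m U V. open U \<and> open V \<and> a \<inter> U \<noteq> {} \<and> b \<inter> V \<noteq> {} \<and>
     (\<forall>A\<in>a \<inter> U. \<exists>s. s \<noteq> 0 \<and> l A = s *s (q - m *s A)) \<and>
     (\<forall>B\<in>b \<inter> V. \<exists>s. s \<noteq> 0 \<and> r B = s *s (q - m *s B)) \<and>
     (\<forall>A\<in>a \<inter> U. \<forall>B\<in>b \<inter> V. lin_indep2 (B - A) (q - m *s A))"
proof -
  obtain A where A: "A \<in> a" using a(2) by blast
  define L where "L = l A"
  obtain K where K: "(l has_derivative (*v) K) (at A)" and NL: "N A \<odot> L \<noteq> 0"
    using a(1) A unfolding framed_patch_def L_def by blast
  have L0: "L \<noteq> 0" using NL by auto
  have key: "K *v v - \<kappa> *s v \<in> vec.span {B - A, L}"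
    if B: "B \<in> b" "lin_indep2 (B - A) L" and s: "s \<noteq> 0" "r B = s *s (L + \<kappa> *s (B - A))" and v: "N A \<odot> v = 0"
    for B s \<kappa> v
  proof -
    obtain \<gamma> where \<gamma>: "\<gamma> 0 = A" "\<forall>\<^sub>F t in nhds 0. \<gamma> t \<in> a" "has_velocity \<gamma> v"
      using framed_patch_curve[OF a(1) A v] by blast
    have ind: "lin_indep2 (r B) (B - A)"
      unfolding lin_indep2_def
    proof (intro allI impI)
      fix p q assume "p *s r B + q *s (B - A) = 0"
      then have "(p * s * \<kappa> + q) *s (B - A) + (p * s) *s L = 0"
        unfolding s(2) by (simp add: scale_simps algebra_simps)
      with B(2) have "p * s * \<kappa> + q = 0 \<and> p * s = 0" unfolding lin_indep2_def by blast
      with s(1) show "p = 0 \<and> q = 0" by auto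
    qed
    have "K *v v - (1 / s) *s 0 - (- \<kappa>) *s (0 - v) \<in> vec.span {r B, B - \<gamma> 0}"
    proof (rule velocity_in_span[where x = "\<lambda>t. r B" and y = "\<lambda>t. B - \<gamma> t" and z = "\<lambda>t. l (\<gamma> t)"])
      show "\<forall>\<^sub>F t in nhds 0. l (\<gamma> t) \<in> vec.span {r B, B - \<gamma> t}"
        using \<gamma>(2)
      proof eventually_elim
        case (elim t)
        from coplanar[OF elim B(1)] obtain s' \<kappa>' where
          s': "s' \<noteq> 0" "r B = s' *s (l (\<gamma> t) + \<kappa>' *s (B - \<gamma> t))" by blast
        then have "l (\<gamma> t) = (1 / s') *s r B + (- \<kappa>') *s (B - \<gamma> t)"
          by (simp add: scale_simps)
        then show ?case unfolding span_pair by blast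
      qed
      show "l (\<gamma> 0) = (1 / s) *s r B + (- \<kappa>) *s (B - \<gamma> 0)"
        using s unfolding \<gamma>(1) L_def by (simp add: scale_simps)
      show "has_velocity (\<lambda>t. B - \<gamma> t) (0 - v)"
        by (intro velocity_intros \<gamma>)
    qed (use \<gamma> ind in \<open>auto intro!: velocity_intros has_velocity_compose[OF K]\<close>)
    then have 1: "K *v v - \<kappa> *s v \<in> vec.span {r B, B - A}"
      using \<gamma>(1) by simp
    have "r B = (s * \<kappa>) *s (B - A) + s *s L"
      unfolding s(2) by (simp add: scale_simps algebra_simps)
    then have "r B \<in> vec.span {B - A, L}" unfolding span_pair by blast
    then have "vec.span {r B, B - A} \<subseteq> vec.span {B - A, L}"
      by (intro vec.span_minimal vec.subspace_span) (auto intro: vec.span_base)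
    with 1 show ?thesis by blast
  qed
  have kappa_eq: "\<kappa>1 = \<kappa>2"
    if B1: "B1 \<in> b" "lin_indep2 (B1 - A) L" "s1 \<noteq> 0" "r B1 = s1 *s (L + \<kappa>1 *s (B1 - A))"
    and B2: "B2 \<in> b" "lin_indep2 (B2 - A) L" "s2 \<noteq> 0" "r B2 = s2 *s (L + \<kappa>2 *s (B2 - A))"
    for B1 s1 \<kappa>1 B2 s2 \<kappa>2
  proof -
    obtain B3 where B3: "B3 \<in> b" "B3 - A \<notin> vec.span {B1 - A, L}" "B3 - A \<notin> vec.span {B2 - A, L}"
      using framed_patch_ex_notin_two_spans[OF card b nt[OF A] B1(2) B2(2)] by blast
    have "B3 - A \<notin> vec.span {L}"
      using B3(2) vec.span_mono[of "{L}" "{B1 - A, L}"] by blast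
    then have ind: "lin_indep2 (B3 - A) L"
      using lin_indep2_iff_notin_span[OF L0] by blast
    obtain s3 \<kappa>3 where s3: "s3 \<noteq> 0" "r B3 = s3 *s (L + \<kappa>3 *s (B3 - A))"
      using coplanar[OF A B3(1)] unfolding L_def by blast
    \<comment> \<open>The vector \<open>v\<close> is the projection of \<open>B3 - A\<close> to the
      tangent space along \<open>L\<close>; modulo \<open>L\<close> it may be replaced by
      \<open>B3 - A\<close>.\<close>
    define c where "c = (N A \<odot> (B3 - A)) / (N A \<odot> L)"
    define v where "v = B3 - A - c *s L"
    have v: "N A \<odot> v = 0" using NL by (simp add: v_def c_def)
    obtain p q where "K *v v - \<kappa>3 *s v = p *s (B3 - A) + q *s L"
      using key[OF B3(1) ind s3 v] unfolding span_pair by blast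
    then have Kv: "K *v v = (p + \<kappa>3) *s (B3 - A) + (q - \<kappa>3 * c) *s L"
      by (simp add: v_def scale_simps algebra_simps)
    \<comment> \<open>Modulo \<open>L\<close>, \<open>K *v v\<close> is \<open>p + \<kappa>3\<close>
      times \<open>B3 - A\<close>. As \<open>B3 - A\<close> is outside the plane of \<open>e\<close>
      and \<open>L\<close>, this coefficient must be \<kappa>. Taking \<open>B1 - A\<close> and
      \<open>B2 - A\<close> for \<open>e\<close> identifies \<open>\<kappa>1\<close> with
      \<open>\<kappa>2\<close>.\<close>
    have "p + \<kappa>3 = \<kappa>" if "K *v v - \<kappa> *s v \<in> vec.span {e, L}" "B3 - A \<notin> vec.span {e, L}" for \<kappa> e
    proof (rule ccontr)
      assume ne: "p + \<kappa>3 \<noteq> \<kappa>"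
      have "K *v v - \<kappa> *s v = (p + \<kappa>3 - \<kappa>) *s (B3 - A) + (q - \<kappa>3 * c + \<kappa> * c) *s L"
        unfolding Kv by (simp add: v_def scale_simps algebra_simps)
      moreover have "(q - \<kappa>3 * c + \<kappa> * c) *s L \<in> vec.span {e, L}"
        by (intro vec.span_scale vec.span_base) simp
      ultimately have "(p + \<kappa>3 - \<kappa>) *s (B3 - A) \<in> vec.span {e, L}"
        using that(1) vec.span_diff by (metis add_diff_cancel_right')
      with ne that(2) show False using in_span_scaleD by (metis right_minus_eq)
    qed
    then show ?thesis
      using key[OF B1 v] key[OF B2 v] B3 by metis
  qed
  obtain u where "u \<notin> vec.span {L, 0}"
    using ex_notin_span_pair[OF card] by blast
  then have "u \<notin> vec.span {L}"
    using vec.span_mono[of "{L}" "{L, 0}"] by blast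
  then have "lin_indep2 u L" using lin_indep2_iff_notin_span[OF L0] by blast
  then obtain B0 where B0: "B0 \<in> b" "B0 - A \<notin> vec.span {u, L}"
    using framed_patch_ex_notin_two_spans[OF card b nt[OF A]] by blast
  then have "B0 - A \<notin> vec.span {L}"
    using vec.span_mono[of "{L}" "{u, L}"] by blast
  then have ind0: "lin_indep2 (B0 - A) L" using lin_indep2_iff_notin_span[OF L0] by blast
  obtain s0 \<kappa> where s0: "s0 \<noteq> 0" "r B0 = s0 *s (L + \<kappa> *s (B0 - A))"
    using coplanar[OF A B0(1)] unfolding L_def by blast
  \<comment> \<open>With these choices \<open>L + \<kappa> *s (B - A)\<close> equals
    \<open>q - m *s B\<close> for every \<open>B\<close>.\<close>
  define m where "m = - \<kappa>"
  define q where "q = L + m *s A"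
  have qA: "q - m *s A = L" by (simp add: q_def)
  obtain i j where ij: "(B0 - A) $ i * (q - m *s A) $ j - (B0 - A) $ j * (q - m *s A) $ i \<noteq> 0"
    using ind0 unfolding lin_indep2_iff_minor qA by blast
  let ?S = "{(A, B). (B - A) $ i * (q - m *s A) $ j - (B - A) $ j * (q - m *s A) $ i \<noteq> 0}"
  have "?S = {x. (snd x - fst x) $ i * (q - m *s fst x) $ j - (snd x - fst x) $ j * (q - m *s fst x) $ i \<noteq> 0}"
    by auto
  moreover have "open \<dots>"
    unfolding vector_minus_component vector_smult_component
    by (intro open_Collect_neq continuous_intros)
  ultimately have "open ?S" by simp
  moreover have "(A, B0) \<in> ?S" using ij by simp
  ultimately obtain U V where UV: "open U" "open V" "(A, B0) \<in> U \<times> V" "U \<times> V \<subseteq> ?S"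
    by (rule open_prod_elim)
  have ind: "lin_indep2 (B' - A') (q - m *s A')" if "A' \<in> U" "B' \<in> V" for A' B'
    using UV(4) that unfolding lin_indep2_iff_minor by blast
  have rB: "\<exists>s. s \<noteq> 0 \<and> r B = s *s (q - m *s B)" if B: "B \<in> b \<inter> V" for B
  proof -
    obtain s \<kappa>' where s: "s \<noteq> 0" "r B = s *s (L + \<kappa>' *s (B - A))"
      using coplanar[OF A, of B] B unfolding L_def by blast
    have "lin_indep2 (B - A) L" using ind[of A B] B UV(3) qA by auto
    from kappa_eq[OF B0(1) ind0 s0 _ this s] B have "\<kappa>' = \<kappa>" by blast
    then have "r B = s *s (q - m *s B)"
      unfolding s(2) by (simp add: q_def m_def scale_simps algebra_simps)
    with s(1) show ?thesis by blast
  qed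
  have lA: "\<exists>s. s \<noteq> 0 \<and> l A' = s *s (q - m *s A')" if A': "A' \<in> a \<inter> U" for A'
  proof -
    define Q where "Q = q - m *s A'"
    \<comment> \<open>For every \<open>B\<close> the line at \<open>A'\<close> lies in the plane of
      \<open>B - A'\<close> and \<open>Q\<close>; two different planes of this kind share only the
      line of \<open>Q\<close>.\<close>
    have in_span: "l A' \<in> vec.span {B - A', Q}" if B: "B \<in> b \<inter> V" for B
    proof -
      obtain s where s: "s \<noteq> 0" "r B = s *s (q - m *s B)" using rB[OF B] by blast
      obtain s' \<kappa>' where s': "s' \<noteq> 0" "r B = s' *s (l A' + \<kappa>' *s (B - A'))"
        using coplanar[of A' B] A' B by blast
      have "l A' = (1 / s') *s r B - \<kappa>' *s (B - A')"
        unfolding s'(2) using s'(1) by (simp add: scale_simps)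
      also have "\<dots> = (- m * s / s' - \<kappa>') *s (B - A') + (s / s') *s Q"
        unfolding s(2) Q_def by (simp add: scale_simps algebra_simps)
      finally show ?thesis unfolding span_pair by blast
    qed
    have B0V: "B0 \<in> b \<inter> V" using B0(1) UV(3) by blast
    have i0: "lin_indep2 (B0 - A') Q" unfolding Q_def using ind A' B0V by blast
    obtain B where B: "B \<in> b \<inter> V" "B - A' \<notin> vec.span {B0 - A', Q}"
      using framed_patch_ex_notin_span[OF card b(1) B0(1) nt[OF _ B0(1)] UV(2) _ i0] A' B0V by blast
    obtain x y where xy: "l A' = x *s (B0 - A') + y *s Q" using in_span[OF B0V] unfolding span_pair by blast
    obtain x' y' where xy': "l A' = x' *s (B - A') + y' *s Q" using in_span[OF B(1)] unfolding span_pair by blast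
    have "x' = 0"
    proof (rule ccontr)
      assume "x' \<noteq> 0"
      have "x' *s (B - A') = x *s (B0 - A') + (y - y') *s Q"
        using xy xy' by (simp add: vec.scale_left_diff_distrib) (metis add_diff_cancel_right' add_diff_eq)
      then have "x' *s (B - A') \<in> vec.span {B0 - A', Q}" unfolding span_pair by blast
      with \<open>x' \<noteq> 0\<close> B(2) show False using in_span_scaleD by blast
    qed
    moreover have "l A' \<noteq> 0" using a(1) A' unfolding framed_patch_def by auto
    ultimately have "l A' = y' *s Q" "y' \<noteq> 0" using xy' by auto
    then show ?thesis unfolding Q_def by blast
  qed
  show ?thesis
    using UV ind rB lA A B0(1) by (intro exI[of _ q] exI[of _ m] exI[of _ U] exI[of _ V]) auto
qed

subsection \<open>Triangles with concurrent lines\<close>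

text \<open>The map \<open>x - (2 * (N \<odot> x) / (N \<odot> l)) *s l\<close> negates
  \<open>l\<close> and fixes the kernel of \<open>N\<close>, so on lines it is the harmonic
  involution; \<open>k\<close> lets \<open>y\<close> be any nonzero vector of the image
  line.\<close>

definition reflects :: "'k::field ^ 'n::finite \<Rightarrow> 'k ^ 'n \<Rightarrow> 'k ^ 'n \<Rightarrow> 'k ^ 'n \<Rightarrow> bool" where
  "reflects N l x y \<longleftrightarrow> N \<odot> x \<noteq> 0 \<and> (\<exists>k. k \<noteq> 0 \<and> y = k *s (x - (2 * (N \<odot> x) / (N \<odot> l)) *s l))"

lemma reflects_sym:
  assumes "reflects N l x y" "N \<odot> l \<noteq> 0"
  shows "reflects N l y x"
proof -
  obtain k where k: "N \<odot> x \<noteq> 0" "k \<noteq> 0" "y = k *s (x - (2 * (N \<odot> x) / (N \<odot> l)) *s l)"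
    using assms(1) unfolding reflects_def by blast
  have "2 * (N \<odot> x) / (N \<odot> l) * (N \<odot> l) = 2 * (N \<odot> x)" using assms(2) by simp
  then have Ny: "N \<odot> y = - k * (N \<odot> x)"
    unfolding k(3) bdot_simps by (simp add: algebra_simps)
  define T where "T = 2 * (N \<odot> x) / (N \<odot> l)"
  have T: "2 * (N \<odot> y) / (N \<odot> l) = - k * T" unfolding Ny T_def by simp
  have "x = (1 / k) *s (y - (2 * (N \<odot> y) / (N \<odot> l)) *s l)"
    unfolding T unfolding k(3) T_def[symmetric] using k(2) by (simp add: vec_eq_iff algebra_simps)
  moreover have "N \<odot> y \<noteq> 0" "1 / k \<noteq> 0" using Ny k(1,2) by simp_all
  ultimately show ?thesis unfolding reflects_def by blast
qed

text \<open>The determinant of the coordinates of \<open>x\<close> and \<open>y\<close> is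
  annihilated by both \<open>n \<odot> e\<close> and \<open>n \<odot> f\<close>, and
  \<open>z\<close> shows that these are not both zero.\<close>

lemma span_pair_kernel_unique:
  assumes "x \<in> vec.span {e, f}" "y \<in> vec.span {e, f}" "z \<in> vec.span {e, f :: 'k::field ^ 'n::finite}"
    and "n \<odot> x = 0" "n \<odot> y = 0" "n \<odot> z \<noteq> 0" "x \<noteq> 0"
  shows "\<exists>\<tau>. y = \<tau> *s x"
proof -
  obtain x1 x2 y1 y2 z1 z2 where xyz: "x = x1 *s e + x2 *s f" "y = y1 *s e + y2 *s f" "z = z1 *s e + z2 *s f"
    using assms(1-3) unfolding span_pair by blast
  define E where "E = n \<odot> e"
  define F where "F = n \<odot> f"
  have n: "x1 * E + x2 * F = 0" "y1 * E + y2 * F = 0" "z1 * E + z2 * F \<noteq> 0"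
    using assms(4-6) unfolding xyz E_def F_def by simp_all
  have "E * (x1 * y2 - x2 * y1) = (x1 * E + x2 * F) * y2 - (y1 * E + y2 * F) * x2"
    "F * (x1 * y2 - x2 * y1) = (y1 * E + y2 * F) * x1 - (x1 * E + x2 * F) * y1"
    by (simp_all add: algebra_simps)
  then have "x1 * y2 = x2 * y1" using n by auto
  moreover have "x1 \<noteq> 0 \<or> x2 \<noteq> 0" using assms(7) xyz by auto
  ultimately show ?thesis
  proof (elim disjE)
    assume "x1 \<noteq> 0"
    then have "y = (y1 / x1) *s x"
      using \<open>x1 * y2 = x2 * y1\<close> unfolding xyz by (simp add: vec_eq_iff field_simps)
    then show ?thesis by blast
  next
    assume "x2 \<noteq> 0"
    then have "y = (y2 / x2) *s x"
      using \<open>x1 * y2 = x2 * y1\<close> unfolding xyz by (simp add: vec_eq_iff field_simps)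
    then show ?thesis by blast
  qed
qed

text \<open>The frame near the third vertex is quantified separately for each triangle, since
  \<open>C\<close> may be any point of \<open>c\<close>. The line field \<open>L\<close>, given once
  for all of \<open>c\<close>, makes frames chosen for different triangles comparable.\<close>

locale cone_billiard =
  fixes a b c :: "('k::real_normed_field ^ 'n::finite) set"
    and N M :: "'k ^ 'n \<Rightarrow> 'k ^ 'n" and L :: "'k ^ 'n \<Rightarrow> ('k ^ 'n) set"
    and q :: "'k ^ 'n" and m :: 'k
  assumes card: "CARD('n) \<ge> 3"
    and a: "framed_patch a N (\<lambda>A. q - m *s A)" and b: "framed_patch b M (\<lambda>B. q - m *s B)"
    and N1: "A \<in> a \<Longrightarrow> N A \<odot> (q - m *s A) = 1" and M1: "B \<in> b \<Longrightarrow> M B \<odot> (q - m *s B) = 1"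
    and indep: "A \<in> a \<Longrightarrow> B \<in> b \<Longrightarrow> lin_indep2 (B - A) (q - m *s A)"
    and triangle: "A \<in> a \<Longrightarrow> B \<in> b \<Longrightarrow> \<exists>C\<in>c. reflects (N A) (q - m *s A) (B - A) (C - A) \<and>
       reflects (M B) (q - m *s B) (A - B) (C - B) \<and>
       (\<exists>U P l. open U \<and> C \<in> U \<and> framed_patch (c \<inter> U) P l \<and> (\<forall>C'\<in>c \<inter> U. L C' = vec.span {l C'}) \<and>
          reflects (P C) (l C) (B - C) (A - C))"
begin

definition \<alpha> where "\<alpha> A B = N A \<odot> (B - A)"
definition \<beta> where "\<beta> A B = M B \<odot> (A - B)"
definition \<sigma> where "\<sigma> A B = 1 / \<alpha> A B + 1 / \<beta> A B - 2 * m"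
text \<open>
  With \<open>A\<close>, \<open>B\<close> and the centre \<open>(q, m)\<close> lifted to homogeneous coordinates \<open>(A, 1)\<close>, \<open>(B, 1)\<close>,
  \<open>(q, m)\<close>, the third vertex is \<open>A / \<beta> + B / \<alpha> - 2 (q, m)\<close>, with last coordinate \<open>\<sigma>\<close>.
\<close>

definition third where
  "third A B = (1 / \<sigma> A B) *s ((1 / \<beta> A B) *s A + (1 / \<alpha> A B) *s B - 2 *s q)"

lemma nonzero: "A \<in> a \<Longrightarrow> B \<in> b \<Longrightarrow> \<alpha> A B \<noteq> 0" "A \<in> a \<Longrightarrow> B \<in> b \<Longrightarrow> \<beta> A B \<noteq> 0"
  using triangle unfolding reflects_def \<alpha>_def \<beta>_def by blast+

text \<open>Both reflected sides lie in the plane with basis \<open>B - A\<close>,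
  \<open>q - m *s A\<close>. Comparing coordinates of their common point gives two linear equations
  for \<open>k\<close> and \<open>k'\<close>, whose solution satisfies
  \<open>k * \<alpha> A B * \<sigma> A B = 1\<close>.\<close>

lemma third_unique:
  assumes AB: "A \<in> a" "B \<in> b"
    and r: "reflects (N A) (q - m *s A) (B - A) (C - A)" "reflects (M B) (q - m *s B) (A - B) (C - B)"
  shows "\<sigma> A B \<noteq> 0" "C = third A B"
    "\<exists>k. k \<noteq> 0 \<and> C - A = k *s (B - A) - (2 * k * \<alpha> A B) *s (q - m *s A)"
proof -
  define e where "e = B - A"
  define l where "l = q - m *s A"
  have qB: "q - m *s B = l - m *s e" by (simp add: l_def e_def scale_simps)
  obtain k where k: "k \<noteq> 0" "C - A = k *s (e - (2 * \<alpha> A B) *s l)"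
    using r(1) unfolding reflects_def N1[OF AB(1)] \<alpha>_def e_def l_def div_by_1 by blast
  obtain k' where "k' \<noteq> 0" "C - B = k' *s (A - B - (2 * \<beta> A B) *s (q - m *s B))"
    using r(2) unfolding reflects_def M1[OF AB(2)] \<beta>_def div_by_1 by blast
  then have k': "k' \<noteq> 0" "C - B = k' *s (- e - (2 * \<beta> A B) *s (l - m *s e))"
    unfolding qB by (simp_all add: e_def)
  have "C - A = e + (C - B)" by (simp add: e_def)
  then have "k *s e + (- 2 * k * \<alpha> A B) *s l = (1 - k' + 2 * k' * \<beta> A B * m) *s e + (- 2 * k' * \<beta> A B) *s l"
    unfolding k(2) k'(2) by (simp add: scale_simps algebra_simps)
  from lin_indep2_eq[OF _ this] indep[OF AB]
  have "k = 1 - k' + 2 * k' * \<beta> A B * m" "- 2 * k * \<alpha> A B = - 2 * k' * \<beta> A B"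
    unfolding e_def l_def by blast+
  then have 1: "k = 1 - k' + 2 * k' * \<beta> A B * m" "k * \<alpha> A B = k' * \<beta> A B"
    by (blast, simp only: mult.assoc mult_cancel_left) simp
  have k'_eq: "k' = k * \<alpha> A B / \<beta> A B" using 1(2) nonzero(2)[OF AB] by (simp add: field_simps)
  have "k * \<alpha> A B * \<sigma> A B = k + k' - 2 * (k' * \<beta> A B) * m"
    unfolding \<sigma>_def 1(2)[symmetric] k'_eq using nonzero[OF AB] by (simp add: field_simps)
  also have "\<dots> = 1" by (subst 1(1)) (simp add: algebra_simps)
  finally have s: "k * \<alpha> A B * \<sigma> A B = 1" .
  from s show s0: "\<sigma> A B \<noteq> 0" by auto
  have ks: "k * \<sigma> A B = 1 / \<alpha> A B" using s nonzero[OF AB] by (simp add: field_simps)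
  have "\<sigma> A B *s (C - A) = (1 / \<alpha> A B) *s e - 2 *s l"
    unfolding k(2) using ks nonzero[OF AB]
    by (simp add: scale_simps) (metis (no_types, lifting) ks mult.commute mult.left_commute mult.right_neutral nonzero_mult_div_cancel_left times_divide_eq_right)
  then have "\<sigma> A B *s C = (1 / \<alpha> A B) *s e - 2 *s l + \<sigma> A B *s A"
    by (simp add: scale_simps algebra_simps)
  also have "\<dots> = (1 / \<beta> A B) *s A + (1 / \<alpha> A B) *s B - 2 *s q"
    unfolding e_def l_def \<sigma>_def by (simp add: vec_eq_iff algebra_simps)
  finally show "C = third A B"
    unfolding third_def using s0 by (metis vec.scale_scale vec.scale_one nonzero_eq_divide_eq mult.commute)
  show "\<exists>k. k \<noteq> 0 \<and> C - A = k *s (B - A) - (2 * k * \<alpha> A B) *s (q - m *s A)"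
    using k unfolding e_def l_def by (intro exI[of _ k]) (simp add: scale_simps mult_ac)
qed

lemma third_in: "A \<in> a \<Longrightarrow> B \<in> b \<Longrightarrow> third A B \<in> c"
  using triangle third_unique(2) by metis

lemma \<sigma>_nonzero: "A \<in> a \<Longrightarrow> B \<in> b \<Longrightarrow> \<sigma> A B \<noteq> 0"
  using triangle third_unique(1) by metis

lemma third_diff:
  assumes "A \<in> a" "B \<in> b"
  shows "\<exists>k. k \<noteq> 0 \<and> third A B - A = k *s (B - A) - (2 * k * \<alpha> A B) *s (q - m *s A)"
  using triangle[OF assms] third_unique(2,3)[OF assms] by metis

lemma scaled_third:
  assumes "A \<in> a" "B \<in> b"
  shows "\<sigma> A B *s third A B = (1 / \<beta> A B) *s A + (1 / \<alpha> A B) *s B - 2 *s q"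
  using \<sigma>_nonzero[OF assms] by (simp add: third_def)

section \<open>Motion of the third vertex\<close>

definition third_frame where
  "third_frame A B U P l \<longleftrightarrow> open U \<and> third A B \<in> U \<and> framed_patch (c \<inter> U) P l \<and>
     (\<forall>C'\<in>c \<inter> U. L C' = vec.span {l C'}) \<and>
     reflects (P (third A B)) (l (third A B)) (B - third A B) (A - third A B)"

lemma ex_third_frame:
  assumes "A \<in> a" "B \<in> b"
  obtains U P l where "third_frame A B U P l"
  using triangle[OF assms] third_unique(2)[OF assms] unfolding third_frame_def by metis

text \<open>
  \<open>\<Phi>\<close> is \<open>\<sigma>\<close> times the velocity of the third vertex when \<open>A\<close> and \<open>B\<close> move with velocities \<open>v\<close> and
  \<open>w\<close>; \<open>J\<close> and \<open>K\<close> are the Jacobian matrices of \<open>N\<close> at \<open>A\<close> and of \<open>M\<close> at \<open>B\<close>.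
\<close>

definition \<Phi> where
  "\<Phi> A B J K v w = (1 / \<beta> A B) *s v + (1 / \<alpha> A B) *s w
     - (((K *v w) \<odot> (A - B) + M B \<odot> v) / (\<beta> A B)\<^sup>2) *s (A - third A B)
     - (((J *v v) \<odot> (B - A) + N A \<odot> w) / (\<alpha> A B)\<^sup>2) *s (B - third A B)"

text \<open>Differentiate \<sigma> C = A / \<beta> + B / \<alpha> - 2 q. The derivatives of
  1/\<alpha> and 1/\<beta> also occur in that of \<sigma>, and moving this part to the right turns
  \<open>A\<close> and \<open>B\<close> into \<open>A - C\<close> and \<open>B - C\<close>.\<close>

lemma velocity_third:
  assumes AB: "A \<in> a" "B \<in> b" and v: "N A \<odot> v = 0" and w: "M B \<odot> w = 0"
    and J: "(N has_derivative (*v) J) (at A)" and K: "(M has_derivative (*v) K) (at B)"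
    and \<gamma>: "\<gamma> 0 = A" "has_velocity \<gamma> v" and \<delta>: "\<delta> 0 = B" "has_velocity \<delta> w"
  shows "has_velocity (\<lambda>t. third (\<gamma> t) (\<delta> t)) ((1 / \<sigma> A B) *s \<Phi> A B J K v w)"
proof -
  define \<alpha>' where "\<alpha>' = (J *v v) \<odot> (B - A) + N A \<odot> w"
  define \<beta>' where "\<beta>' = (K *v w) \<odot> (A - B) + M B \<odot> v"
  note nz = nonzero[OF AB] \<sigma>_nonzero[OF AB]
  have "((\<lambda>t. N (\<gamma> t) \<odot> (\<delta> t - \<gamma> t)) has_field_derivative
      (J *v v) \<odot> (\<delta> 0 - \<gamma> 0) + N (\<gamma> 0) \<odot> (w - v)) (at 0)"
    by (intro velocity_intros has_velocity_compose[OF J] \<gamma> \<delta>)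
  then have d\<alpha>: "((\<lambda>t. \<alpha> (\<gamma> t) (\<delta> t)) has_field_derivative \<alpha>') (at 0)"
    unfolding \<alpha>_def \<alpha>'_def \<gamma>(1) \<delta>(1) using v by (simp add: algebra_simps)
  have "((\<lambda>t. M (\<delta> t) \<odot> (\<gamma> t - \<delta> t)) has_field_derivative
      (K *v w) \<odot> (\<gamma> 0 - \<delta> 0) + M (\<delta> 0) \<odot> (v - w)) (at 0)"
    by (intro velocity_intros has_velocity_compose[OF K] \<gamma> \<delta>)
  then have d\<beta>: "((\<lambda>t. \<beta> (\<gamma> t) (\<delta> t)) has_field_derivative \<beta>') (at 0)"
    unfolding \<beta>_def \<beta>'_def \<gamma>(1) \<delta>(1) using w by (simp add: algebra_simps)
  have i\<alpha>: "((\<lambda>t. 1 / \<alpha> (\<gamma> t) (\<delta> t)) has_field_derivative - \<alpha>' / (\<alpha> A B)\<^sup>2) (at 0)"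
    using nz d\<alpha> by (auto intro!: derivative_eq_intros simp: \<gamma>(1) \<delta>(1) power2_eq_square)
  have i\<beta>: "((\<lambda>t. 1 / \<beta> (\<gamma> t) (\<delta> t)) has_field_derivative - \<beta>' / (\<beta> A B)\<^sup>2) (at 0)"
    using nz d\<beta> by (auto intro!: derivative_eq_intros simp: \<gamma>(1) \<delta>(1) power2_eq_square)
  define \<sigma>' where "\<sigma>' = - \<alpha>' / (\<alpha> A B)\<^sup>2 + - \<beta>' / (\<beta> A B)\<^sup>2"
  have d\<sigma>: "((\<lambda>t. \<sigma> (\<gamma> t) (\<delta> t)) has_field_derivative \<sigma>') (at 0)"
    unfolding \<sigma>_def \<sigma>'_def using DERIV_diff[OF DERIV_add[OF i\<alpha> i\<beta>] DERIV_const] by simp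
  have i\<sigma>: "((\<lambda>t. 1 / \<sigma> (\<gamma> t) (\<delta> t)) has_field_derivative - \<sigma>' / (\<sigma> A B)\<^sup>2) (at 0)"
    using nz d\<sigma> by (auto intro!: derivative_eq_intros simp: \<gamma>(1) \<delta>(1) power2_eq_square)
  define S where "S = (1 / \<beta> A B) *s A + (1 / \<alpha> A B) *s B - 2 *s q"
  define S' where "S' = (- \<beta>' / (\<beta> A B)\<^sup>2) *s A + (1 / \<beta> A B) *s v +
        ((- \<alpha>' / (\<alpha> A B)\<^sup>2) *s B + (1 / \<alpha> A B) *s w)"
  have dS: "has_velocity (\<lambda>t. (1 / \<beta> (\<gamma> t) (\<delta> t)) *s \<gamma> t + (1 / \<alpha> (\<gamma> t) (\<delta> t)) *s \<delta> t - 2 *s q) S'"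
    using has_velocity_diff[OF has_velocity_add[OF has_velocity_scale[OF i\<beta> \<gamma>(2)]
          has_velocity_scale[OF i\<alpha> \<delta>(2)]] has_velocity_const[of "2 *s q"]]
    by (simp add: S'_def \<gamma>(1) \<delta>(1))
  have "has_velocity (\<lambda>t. third (\<gamma> t) (\<delta> t)) ((- \<sigma>' / (\<sigma> A B)\<^sup>2) *s S + (1 / \<sigma> A B) *s S')"
    using has_velocity_scale[OF i\<sigma> dS] unfolding third_def by (simp add: S_def \<gamma>(1) \<delta>(1))
  moreover have "(- \<sigma>' / (\<sigma> A B)\<^sup>2) *s S = (1 / \<sigma> A B) *s ((- \<sigma>') *s third A B)"
    using nz unfolding third_def S_def[symmetric] by (simp add: power2_eq_square)
  moreover have "(- \<sigma>') *s third A B + S' = \<Phi> A B J K v w"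
    unfolding \<Phi>_def S'_def \<alpha>'_def[symmetric] \<beta>'_def[symmetric] \<sigma>'_def
    by (simp add: vec_eq_iff algebra_simps)
  ultimately show ?thesis by (metis vec.scale_right_distrib)
qed

lemma \<Phi>_tangent:
  assumes AB: "A \<in> a" "B \<in> b" and v: "N A \<odot> v = 0" and w: "M B \<odot> w = 0"
    and J: "(N has_derivative (*v) J) (at A)" and K: "(M has_derivative (*v) K) (at B)"
    and fr: "third_frame A B U P l"
  shows "P (third A B) \<odot> \<Phi> A B J K v w = 0"
proof -
  obtain \<gamma> where \<gamma>: "\<gamma> 0 = A" "\<forall>\<^sub>F t in nhds 0. \<gamma> t \<in> a" "has_velocity \<gamma> v"
    using framed_patch_curve[OF a AB(1) v] by blast
  obtain \<delta> where \<delta>: "\<delta> 0 = B" "\<forall>\<^sub>F t in nhds 0. \<delta> t \<in> b" "has_velocity \<delta> w"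
    using framed_patch_curve[OF b AB(2) w] by blast
  have U: "open U" "third A B \<in> U" "framed_patch (c \<inter> U) P l"
    using fr unfolding third_frame_def by auto
  have "\<forall>\<^sub>F t in nhds 0. third (\<gamma> t) (\<delta> t) \<in> c"
    using \<gamma>(2) \<delta>(2) by eventually_elim (rule third_in)
  then have "(1 / \<sigma> A B) *s \<Phi> A B J K v w \<in> tangent_space c (third A B)"
    unfolding tangent_space_eq_velocities
    using velocity_third[OF AB v w J K \<gamma>(1,3) \<delta>(1,3)] \<gamma>(1) \<delta>(1)
    by (intro CollectI exI[of _ "\<lambda>t. third (\<gamma> t) (\<delta> t)"]) auto
  moreover have "tangent_space c (third A B) = {u. P (third A B) \<odot> u = 0}"
    using U third_in[OF AB] unfolding framed_patch_def tangent_space_Int_open[OF U(1,2), of c, symmetric]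
    by blast
  ultimately have "P (third A B) \<odot> ((1 / \<sigma> A B) *s \<Phi> A B J K v w) = 0"
    by blast
  then show ?thesis using \<sigma>_nonzero[OF AB] by simp
qed

text \<open>The plane of the triangle, based at \<open>C\<close> because
  \<open>frame_at_third\<close> keeps \<open>C\<close> stationary while \<open>A\<close> moves. The
  line at \<open>C\<close> lies in it since the reflection law writes a nonzero multiple of
  \<open>l C\<close> through \<open>B - C\<close> and \<open>A - C\<close>.\<close>

lemma plane_of_third:
  assumes AB: "A \<in> a" "B \<in> b" and fr: "third_frame A B U P l"
  defines "C \<equiv> third A B"
  defines "S \<equiv> vec.span {A - C, q - m *s C}"
  shows "lin_indep2 (A - C) (q - m *s C)" "B - A \<in> S" "q - m *s A \<in> S" "q - m *s B \<in> S"
    "B - C \<in> S" "A - C \<in> S" "l C \<in> S"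
proof -
  obtain k where k: "k \<noteq> 0" "C - A = k *s (B - A) - (2 * k * \<alpha> A B) *s (q - m *s A)"
    using third_diff[OF AB] unfolding C_def by blast
  show S1: "A - C \<in> S" unfolding S_def by (auto intro: vec.span_base)
  have S2: "q - m *s C \<in> S" unfolding S_def by (auto intro: vec.span_base)
  have "q - m *s A = q - m *s C - m *s (A - C)" by (simp add: scale_simps)
  then show S3: "q - m *s A \<in> S"
    using S1 S2 unfolding S_def by (metis vec.span_diff vec.span_scale)
  have "k *s (B - A) = (2 * k * \<alpha> A B) *s (q - m *s A) - (A - C)"
    using k(2) by (simp add: algebra_simps)
  then have "k *s (B - A) \<in> S"
    using S1 S3 unfolding S_def by (metis vec.span_diff vec.span_scale)
  with k(1) show S4: "B - A \<in> S" unfolding S_def using in_span_scaleD by blast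
  have "q - m *s B = q - m *s A - m *s (B - A)" by (simp add: scale_simps)
  then show "q - m *s B \<in> S"
    using S3 S4 unfolding S_def by (metis vec.span_diff vec.span_scale)
  have "B - C = B - A + (A - C)" by simp
  then show S5: "B - C \<in> S"
    using S1 S4 unfolding S_def by (metis vec.span_add)
  define x where "x = 2 * (P C \<odot> (B - C)) / (P C \<odot> l C)"
  have "reflects (P C) (l C) (B - C) (A - C)" "P C \<odot> l C \<noteq> 0"
    using fr third_in[OF AB] unfolding third_frame_def C_def framed_patch_def by auto
  then obtain k' where k': "k' \<noteq> 0" "A - C = k' *s (B - C - x *s l C)" and x: "x \<noteq> 0"
    unfolding reflects_def x_def by auto
  have "x *s l C = B - C - (1 / k') *s (A - C)"
    unfolding k'(2) using k'(1) by simp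
  then have "x *s l C \<in> S"
    using S5 S1 unfolding S_def by (metis vec.span_diff vec.span_scale)
  with x show "l C \<in> S" unfolding S_def using in_span_scaleD by blast
  show "lin_indep2 (A - C) (q - m *s C)"
    unfolding lin_indep2_def
  proof (intro allI impI)
    fix p r assume pr: "p *s (A - C) + r *s (q - m *s C) = 0"
    have "p *s (A - C) + r *s (q - m *s C) = - ((p + r * m) *s (C - A)) + r *s (q - m *s A)"
      by (simp add: scale_simps algebra_simps)
    also have "\<dots> = (- (p + r * m) * k) *s (B - A) + ((p + r * m) * (2 * k * \<alpha> A B) + r) *s (q - m *s A)"
      unfolding k(2) by (simp add: vec_eq_iff algebra_simps)
    finally have "- (p + r * m) * k = 0 \<and> (p + r * m) * (2 * k * \<alpha> A B) + r = 0"
      using indep[OF AB] unfolding pr lin_indep2_def by metis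
    with k(1) have "p + r * m = 0" "r = 0" by (auto simp del: minus_add_distrib)
    then show "p = 0 \<and> r = 0" by simp
  qed
qed

text \<open>Eliminating the last homogeneous coordinate from the formula for \<open>C\<close>
  expresses the direction from \<open>C\<close> to the common point through the two sides at
  \<open>C\<close>.\<close>

lemma opposite_sides:
  assumes "A \<in> a" "B \<in> b"
  shows "2 *s (q - m *s third A B) = (1 / \<beta> A B) *s (A - third A B) + (1 / \<alpha> A B) *s (B - third A B)"
proof -
  have "(1 / \<beta> A B) *s (A - third A B) + (1 / \<alpha> A B) *s (B - third A B)
      = ((1 / \<beta> A B) *s A + (1 / \<alpha> A B) *s B - 2 *s q) - (\<sigma> A B + 2 * m) *s third A B + 2 *s q"
    by (simp add: \<sigma>_def vec_eq_iff algebra_simps)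
  also have "\<dots> = 2 *s (q - m *s third A B)"
    unfolding scaled_third[OF assms, symmetric] by (simp add: vec_eq_iff algebra_simps)
  finally show ?thesis by simp
qed

text \<open>
  Since \<open>d \<ge> 3\<close>, \<open>A\<close> can leave the plane of the triangle while \<open>B\<close> moves so that the third vertex
  is stationary. Its line lies in the plane of each of these triangles, hence in their common line.
\<close>

lemma frame_at_third:
  assumes AB: "A \<in> a" "B \<in> b" and fr: "third_frame A B U P l"
  shows "\<exists>s. s \<noteq> 0 \<and> l (third A B) = s *s (q - m *s third A B)"
proof -
  define C where "C = third A B"
  define S where "S = vec.span {A - C, q - m *s C}"
  note S = plane_of_third[OF AB fr, folded C_def, folded S_def]
  note nz = nonzero[OF AB] \<sigma>_nonzero[OF AB]
  obtain J where J: "(N has_derivative (*v) J) (at A)"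
    using a AB(1) unfolding framed_patch_def by blast
  obtain K where K: "(M has_derivative (*v) K) (at B)"
    using b AB(2) unfolding framed_patch_def by blast
  have U: "open U" "C \<in> U" "framed_patch (c \<inter> U) P l" "\<And>C'. C' \<in> c \<inter> U \<Longrightarrow> L C' = vec.span {l C'}"
    "reflects (P C) (l C) (B - C) (A - C)"
    using fr unfolding third_frame_def C_def by auto
  have PC: "P C \<odot> (B - C) \<noteq> 0" using U(5) unfolding reflects_def by blast
  have C: "C \<in> c" using third_in[OF AB] by (simp add: C_def)
  obtain Kl where Kl: "(l has_derivative (*v) Kl) (at C)" and lC: "P C \<odot> l C \<noteq> 0"
    using U(2,3) C unfolding framed_patch_def by blast
  obtain u where u: "u \<notin> S" using ex_notin_span_pair[OF card] unfolding S_def by blast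
  define v where "v = u - (N A \<odot> u) *s (q - m *s A)"
  have v: "N A \<odot> v = 0" unfolding v_def bdot_diff_scale[of _ u] N1[OF AB(1)] by simp
  have vS: "v \<notin> S"
  proof
    assume "v \<in> S"
    then have "v + (N A \<odot> u) *s (q - m *s A) \<in> S"
      using S(3) unfolding S_def by (metis vec.span_add vec.span_scale)
    with u show False by (simp add: v_def)
  qed
  \<comment> \<open>Chosen so that v / \<beta> + w1 / \<alpha> is a multiple of
    \<open>q - m *s B\<close>: the parts outside \<open>S\<close> cancel, which gives
    \<open>F \<in> S\<close> below. The vector \<open>w0\<close> is the projection of
    \<open>A - B\<close> along the line at \<open>B\<close>, a motion of \<open>B\<close> inside the
    plane.\<close>
  define w1 where "w1 = (- \<alpha> A B / \<beta> A B) *s (v - (M B \<odot> v) *s (q - m *s B))"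
  define w0 where "w0 = - (B - A) - \<beta> A B *s (q - m *s B)"
  have w1: "M B \<odot> w1 = 0" unfolding w1_def bdot_simps(10) bdot_diff_scale[of _ v] M1[OF AB(2)] by simp
  have w0: "M B \<odot> w0 = 0"
    unfolding w0_def bdot_diff_scale[of _ "- (B - A)"] M1[OF AB(2)] by (simp add: \<beta>_def)
  have w0S: "w0 \<in> S"
    using S(2,4) unfolding w0_def S_def by (metis vec.span_diff vec.span_scale vec.span_neg)
  define E where "E = \<Phi> A B J K 0 w0"
  define x where "x = (K *v w0) \<odot> (A - B) / (\<beta> A B)\<^sup>2"
  define y where "y = N A \<odot> w0 / (\<alpha> A B)\<^sup>2"
  have E_eq: "E = (1 / \<alpha> A B) *s w0 - x *s (A - C) - y *s (B - C)"
    unfolding E_def \<Phi>_def x_def y_def C_def by simp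
  have ES: "E \<in> S"
    unfolding E_eq S_def using w0S S(5,6)[unfolded S_def]
    by (intro vec.span_diff[OF vec.span_diff[OF vec.span_scale vec.span_scale] vec.span_scale])
      (simp_all only: S_def)
  \<comment> \<open>If \<open>E\<close> vanished, its two coordinates would give two values of
    \<open>(x + y) * k\<close>, forcing \<beta> / \<alpha> = 2 * \<beta> / \<alpha>.\<close>
  have "E \<noteq> 0"
  proof
    assume "E = 0"
    obtain k where k: "k \<noteq> 0" "C - A = k *s (B - A) - (2 * k * \<alpha> A B) *s (q - m *s A)"
      using third_diff[OF AB] unfolding C_def by blast
    have w0_eq: "w0 = (m * \<beta> A B - 1) *s (B - A) - \<beta> A B *s (q - m *s A)"
      unfolding w0_def by (simp add: vec_eq_iff algebra_simps)
    have "N A \<odot> w0 = (m * \<beta> A B - 1) * \<alpha> A B - \<beta> A B"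
      unfolding w0_eq bdot_diff_scale[of _ "_ *s (B - A)"] N1[OF AB(1)] by (simp add: \<alpha>_def algebra_simps)
    then have y: "(m * \<beta> A B - 1) / \<alpha> A B - y = \<beta> A B / (\<alpha> A B)\<^sup>2"
      unfolding y_def using nz by (simp add: diff_divide_distrib power2_eq_square)
    have "E = (1 / \<alpha> A B) *s w0 - y *s (B - A) + (x + y) *s (C - A)"
      unfolding E_eq by (simp add: vec_eq_iff algebra_simps)
    also have "\<dots> = ((m * \<beta> A B - 1) / \<alpha> A B - y + (x + y) * k) *s (B - A)
        + (- \<beta> A B / \<alpha> A B - (x + y) * (2 * k * \<alpha> A B)) *s (q - m *s A)"
      unfolding k(2) w0_eq
      by (simp add: vec_eq_iff algebra_simps diff_divide_distrib add_divide_distrib)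
    finally have "(m * \<beta> A B - 1) / \<alpha> A B - y + (x + y) * k = 0 \<and>
      - \<beta> A B / \<alpha> A B - (x + y) * (2 * k * \<alpha> A B) = 0"
      unfolding \<open>E = 0\<close> by (intro indep[OF AB, unfolded lin_indep2_def, rule_format]) (rule sym)
    then have 1: "\<beta> A B / (\<alpha> A B)\<^sup>2 + (x + y) * k = 0" and
      2: "- \<beta> A B / \<alpha> A B = 2 * \<alpha> A B * ((x + y) * k)"
      unfolding y by (simp_all add: mult_ac)
    have "(x + y) * k = - (\<beta> A B / (\<alpha> A B)\<^sup>2)" using 1 by (simp add: eq_neg_iff_add_eq_0 add.commute)
    with 2 have "- \<beta> A B / \<alpha> A B = - (2 * (\<beta> A B / \<alpha> A B))"
      using nz by (simp add: power2_eq_square)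
    then show False using nz by simp
  qed
  define F where "F = \<Phi> A B J K v w1"
  have FS: "F \<in> S"
  proof -
    have "(1 / \<beta> A B) *s v + (1 / \<alpha> A B) *s w1 = (M B \<odot> v / \<beta> A B) *s (q - m *s B)"
      using nz unfolding w1_def by (simp add: vec_eq_iff field_simps)
    also have "\<dots> \<in> S" using S(4) unfolding S_def by (rule vec.span_scale)
    finally show ?thesis
      unfolding F_def \<Phi>_def C_def[symmetric] S_def using S(5,6)[unfolded S_def]
      by (intro vec.span_diff[OF vec.span_diff[OF _ vec.span_scale] vec.span_scale])
  qed
  \<comment> \<open>\<open>E\<close> and \<open>F\<close> both lie in the kernel of
    \<open>P C\<close> on \<open>S\<close>, which is a line because \<open>P C\<close> does not
    vanish on \<open>B - C\<close>.\<close>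
  have "P C \<odot> E = 0" "P C \<odot> F = 0"
    unfolding E_def F_def C_def using \<Phi>_tangent[OF AB _ _ J K fr] v w0 w1 by auto
  then obtain \<tau> where \<tau>: "F = \<tau> *s E"
    using span_pair_kernel_unique[of E "A - C" "q - m *s C" F "B - C" "P C"] ES FS S(5) PC \<open>E \<noteq> 0\<close>
    unfolding S_def by blast
  \<comment> \<open>\<Phi> is linear in the pair of velocities, so subtracting \<tau> times the
    motion inside the plane stops the third vertex.\<close>
  define w where "w = w1 - \<tau> *s w0"
  have w: "M B \<odot> w = 0" using w0 w1 by (simp add: w_def)
  have "\<Phi> A B J K v w = F - \<tau> *s E"
    unfolding F_def E_def \<Phi>_def w_def
    by (simp add: matrix_vector_mult_diff_distrib vec.scale vec_eq_iff diff_divide_distrib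
        add_divide_distrib algebra_simps)
  then have \<Phi>0: "\<Phi> A B J K v w = 0" using \<tau> by simp
  obtain \<gamma> where \<gamma>: "\<gamma> 0 = A" "\<forall>\<^sub>F t in nhds 0. \<gamma> t \<in> a" "has_velocity \<gamma> v"
    using framed_patch_curve[OF a AB(1) v] by blast
  obtain \<delta> where \<delta>: "\<delta> 0 = B" "\<forall>\<^sub>F t in nhds 0. \<delta> t \<in> b" "has_velocity \<delta> w"
    using framed_patch_curve[OF b AB(2) w] by blast
  define \<zeta> where "\<zeta> t = third (\<gamma> t) (\<delta> t)" for t
  have \<zeta>0: "\<zeta> 0 = C" by (simp add: \<zeta>_def \<gamma>(1) \<delta>(1) C_def)
  have \<zeta>: "has_velocity \<zeta> 0"
    using velocity_third[OF AB v w J K \<gamma>(1,3) \<delta>(1,3)] unfolding \<Phi>0 \<zeta>_def by simp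
  have "\<forall>\<^sub>F t in nhds 0. \<zeta> t \<in> U"
    using has_velocity_tendsto[OF \<zeta>] U(1,2) \<zeta>0 topological_tendstoD by blast
  then have in_span: "\<forall>\<^sub>F t in nhds 0. l (\<zeta> t) \<in> vec.span {\<gamma> t - \<zeta> t, q - m *s \<zeta> t}"
    using \<gamma>(2) \<delta>(2)
  proof eventually_elim
    case (elim t)
    obtain U' P' l' where fr': "third_frame (\<gamma> t) (\<delta> t) U' P' l'"
      using ex_third_frame[OF elim(2,3)] .
    have "l' (\<zeta> t) \<in> vec.span {\<gamma> t - \<zeta> t, q - m *s \<zeta> t}"
      using plane_of_third(7)[OF elim(2,3) fr'] unfolding \<zeta>_def .
    \<comment> \<open>The frame of the triangle at \<open>t\<close> and the one fixed at
      \<open>C\<close> both span \<open>L (\<zeta> t)\<close>.\<close>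
    moreover have "vec.span {l' (\<zeta> t)} = vec.span {l (\<zeta> t)}"
      using U(4)[of "\<zeta> t"] fr' third_in[OF elim(2,3)] elim(1) unfolding third_frame_def \<zeta>_def by auto
    then have "l (\<zeta> t) \<in> vec.span {l' (\<zeta> t)}" by (simp add: vec.span_base)
    ultimately show ?case
      by (metis (no_types, lifting) empty_subsetI insert_subset subsetD vec.span_minimal vec.subspace_span)
  qed
  obtain p r where pr: "l C = p *s (A - C) + r *s (q - m *s C)"
    using S(7) unfolding S_def span_pair by blast
  \<comment> \<open>Since \<zeta> has velocity zero, so does the frame along it; only
    \<open>p *s v\<close> survives, and \<open>v\<close> is not in \<open>S\<close>.\<close>
  have "Kl *v 0 - p *s (v - 0) - r *s (0 - (0 *s \<zeta> 0 + m *s 0)) \<in> vec.span {\<gamma> 0 - \<zeta> 0, q - m *s \<zeta> 0}"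
  proof (rule velocity_in_span[OF _ _ _ in_span])
    show "has_velocity (\<lambda>t. \<gamma> t - \<zeta> t) (v - 0)" "has_velocity (\<lambda>t. q - m *s \<zeta> t) (0 - (0 *s \<zeta> 0 + m *s 0))"
      by (intro velocity_intros \<gamma> \<zeta> DERIV_const)+
    show "has_velocity (\<lambda>t. l (\<zeta> t)) (Kl *v 0)"
      by (rule has_velocity_compose[OF Kl \<zeta>0 \<zeta>])
  qed (use pr S(1) in \<open>simp_all add: \<zeta>0 \<gamma>(1)\<close>)
  then have "- p *s v \<in> S" by (simp add: \<zeta>0 \<gamma>(1) S_def)
  then have "p = 0" using vS in_span_scaleD[of "- p" v] unfolding S_def by auto
  then have "l C = r *s (q - m *s C)" using pr by simp
  moreover have "r \<noteq> 0" using lC calculation by auto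
  ultimately show ?thesis unfolding C_def by blast
qed

text \<open>
  Move \<open>A\<close> in the direction of the projection of \<open>B - A\<close> to the tangent space along the line of the
  frame, with \<open>B\<close> fixed, and use that the third vertex stays on its hypersurface.
\<close>

lemma curvature_relation:
  assumes AB: "A \<in> a" "B \<in> b" and J: "(N has_derivative (*v) J) (at A)"
  shows "(J *v (B - A - \<alpha> A B *s (q - m *s A))) \<odot> (B - A) * \<beta> A B = (\<alpha> A B)\<^sup>2"
proof -
  obtain U P l where fr: "third_frame A B U P l" using ex_third_frame[OF AB] .
  define C where "C = third A B"
  define X where "X = A - C"
  define Y where "Y = B - C"
  define n where "n = P C"
  note nz = nonzero[OF AB]
  obtain s where s: "s \<noteq> 0" "l C = s *s (q - m *s C)"
    using frame_at_third[OF AB fr] unfolding C_def by blast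
  define \<nu> where "\<nu> = n \<odot> (q - m *s C)"
  have C: "C \<in> c \<inter> U" using third_in[OF AB] fr unfolding third_frame_def C_def by blast
  have "n \<odot> l C \<noteq> 0" and r: "reflects n (l C) Y X"
    using fr C unfolding third_frame_def n_def X_def Y_def C_def framed_patch_def by blast+
  then have \<nu>: "\<nu> \<noteq> 0" unfolding s(2) \<nu>_def by auto
  have 2: "2 *s (q - m *s C) = (1 / \<beta> A B) *s X + (1 / \<alpha> A B) *s Y"
    using opposite_sides[OF AB] unfolding C_def X_def Y_def .
  define h where "h = (n \<odot> Y) / \<nu>"
  obtain k where k: "k \<noteq> 0" "X = k *s (Y - (2 * (n \<odot> Y) / (n \<odot> l C)) *s l C)"
    using r unfolding reflects_def by blast
  have hl: "(2 * (n \<odot> Y) / (n \<odot> l C)) *s l C = h *s (2 *s (q - m *s C))"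
    unfolding s(2) bdot_simps(10) \<nu>_def[symmetric] h_def using s(1) \<nu> by (simp add: vec_eq_iff field_simps)
  have X: "X = k *s (Y - h *s ((1 / \<beta> A B) *s X + (1 / \<alpha> A B) *s Y))"
    using k(2) unfolding hl 2 .
  have ind: "lin_indep2 X Y"
    unfolding lin_indep2_def
  proof (intro allI impI)
    fix p r assume pr: "p *s X + r *s Y = 0"
    have "Y = \<alpha> A B *s (2 *s (q - m *s C) - (1 / \<beta> A B) *s X)"
      unfolding 2 using nz by simp
    then have "p *s X + r *s (\<alpha> A B *s (2 *s (q - m *s C) - (1 / \<beta> A B) *s X)) = 0" using pr by simp
    then have "(p - r * \<alpha> A B / \<beta> A B) *s X + (2 * r * \<alpha> A B) *s (q - m *s C) = 0"
      by (simp add: vec_eq_iff algebra_simps)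
    then have "p - r * \<alpha> A B / \<beta> A B = 0 \<and> 2 * r * \<alpha> A B = 0"
      using plane_of_third(1)[OF AB fr] unfolding C_def[symmetric] X_def[symmetric] lin_indep2_def by blast
    then show "p = 0 \<and> r = 0" using nz by auto
  qed
  have "1 *s X + 0 *s Y = (- k * h / \<beta> A B) *s X + (k * (1 - h / \<alpha> A B)) *s Y"
    using X by (simp add: vec_eq_iff algebra_simps)
  \<comment> \<open>In the expansion of \<open>X\<close> the coefficient of \<open>Y\<close> must
    vanish, so \<open>h\<close> is \<alpha>. This fixes the conormal at \<open>C\<close> on the
    plane of the triangle up to the factor \<nu>.\<close>
  from lin_indep2_eq[OF ind this] k(1) have h1: "1 = - k * h / \<beta> A B" and h: "h = \<alpha> A B"
    using nz by (auto simp: field_simps)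
  have nY: "n \<odot> Y = \<alpha> A B * \<nu>" using h \<nu> unfolding h_def by (simp add: field_simps)
  have "2 * \<nu> = (1 / \<beta> A B) * (n \<odot> X) + (1 / \<alpha> A B) * (n \<odot> Y)"
    using arg_cong[OF 2, of "\<lambda>z. n \<odot> z"] unfolding bdot_simps(4,10) \<nu>_def .
  then have nX: "n \<odot> X = \<beta> A B * \<nu>" unfolding nY using nz by (simp add: field_simps)
  define e where "e = B - A"
  define L' where "L' = q - m *s A"
  have e: "e = Y - X" by (simp add: e_def X_def Y_def)
  have L': "L' = (q - m *s C) - m *s X" by (simp add: L'_def X_def scale_simps)
  define v where "v = e - \<alpha> A B *s L'"
  have ne: "n \<odot> e = (\<alpha> A B - \<beta> A B) * \<nu>" unfolding e bdot_simps(6) nX nY by (simp add: algebra_simps)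
  have "n \<odot> L' = \<nu> - m * (n \<odot> X)"
    unfolding L' \<nu>_def by (simp only: bdot_simps)
  then have nL: "n \<odot> L' = (1 - m * \<beta> A B) * \<nu>"
    unfolding nX by (simp add: algebra_simps)
  have nv: "n \<odot> v = (- \<beta> A B + m * \<alpha> A B * \<beta> A B) * \<nu>"
    unfolding v_def bdot_simps(6,10) ne nL by (simp add: algebra_simps)
  have Me: "M B \<odot> e = - \<beta> A B" unfolding e_def \<beta>_def by simp
  have "L' = (q - m *s B) + m *s e" by (simp add: L'_def e_def scale_simps)
  then have ml: "M B \<odot> L' = 1 - m * \<beta> A B"
    using M1[OF AB(2)] Me by (simp del: bdot_simps add: bdot_simps(4,10))
  have Mv: "M B \<odot> v = - \<beta> A B - \<alpha> A B + m * \<alpha> A B * \<beta> A B"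
    unfolding v_def bdot_simps(6,10) Me ml by (simp add: algebra_simps)
  have Nv: "N A \<odot> v = 0"
    unfolding v_def bdot_diff_scale[of _ e] using N1[OF AB(1)] by (simp add: L'_def e_def \<alpha>_def)
  obtain K where K: "(M has_derivative (*v) K) (at B)"
    using b AB(2) unfolding framed_patch_def by blast
  define Q where "Q = (J *v v) \<odot> e"
  \<comment> \<open>\<open>B\<close> is at rest, so \<open>K\<close> drops out and curvature enters
    only through \<open>Q\<close>.\<close>
  have "n \<odot> \<Phi> A B J K v 0 = 0"
    unfolding n_def C_def using \<Phi>_tangent[OF AB Nv _ J K fr] by simp
  then have "(1 / \<beta> A B) * (n \<odot> v) - (M B \<odot> v / (\<beta> A B)\<^sup>2) * (n \<odot> X) - (Q / (\<alpha> A B)\<^sup>2) * (n \<odot> Y) = 0"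
    unfolding \<Phi>_def C_def[symmetric] X_def[symmetric] Y_def[symmetric] e_def[symmetric] Q_def by simp
  then have "\<nu> * ((- \<beta> A B + m * \<alpha> A B * \<beta> A B - (- \<beta> A B - \<alpha> A B + m * \<alpha> A B * \<beta> A B)) / \<beta> A B - Q / \<alpha> A B) = 0"
    unfolding nv nX nY Mv using nz by (simp add: field_simps power2_eq_square)
  then have "\<alpha> A B / \<beta> A B = Q / \<alpha> A B" using \<nu> by simp
  then show ?thesis
    unfolding Q_def v_def e_def L'_def using nz by (simp del: bdot_simps add: field_simps power2_eq_square)
qed

text \<open>Makes everything proved at \<open>A\<close> available at \<open>B\<close>; only the
  reflection at \<open>C\<close> has to be reversed.\<close>

lemma swapped: "cone_billiard b a c M N L q m"
proof
  show "lin_indep2 (A - B) (q - m *s B)" if "B \<in> b" "A \<in> a" for A B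
    unfolding lin_indep2_def
  proof (intro allI impI)
    fix p r assume pr: "p *s (A - B) + r *s (q - m *s B) = 0"
    have "p *s (A - B) + r *s (q - m *s B) = (- p - r * m) *s (B - A) + r *s (q - m *s A)"
      by (simp add: vec_eq_iff algebra_simps)
    with pr indep[OF that(2,1)] have "- p - r * m = 0 \<and> r = 0" unfolding lin_indep2_def by metis
    then have "r = 0" "- p - r * m = 0" by blast+
    then show "p = 0 \<and> r = 0" by simp
  qed
  show "\<exists>C\<in>c. reflects (M B) (q - m *s B) (A - B) (C - B) \<and> reflects (N A) (q - m *s A) (B - A) (C - A) \<and>
       (\<exists>U P l. open U \<and> C \<in> U \<and> framed_patch (c \<inter> U) P l \<and> (\<forall>C'\<in>c \<inter> U. L C' = vec.span {l C'}) \<and>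
          reflects (P C) (l C) (A - C) (B - C))" if AB: "B \<in> b" "A \<in> a" for A B
  proof -
    obtain C where C: "C \<in> c" "reflects (N A) (q - m *s A) (B - A) (C - A)"
      "reflects (M B) (q - m *s B) (A - B) (C - B)"
      and "\<exists>U P l. open U \<and> C \<in> U \<and> framed_patch (c \<inter> U) P l \<and>
        (\<forall>C'\<in>c \<inter> U. L C' = vec.span {l C'}) \<and> reflects (P C) (l C) (B - C) (A - C)"
      using triangle[OF AB(2,1)] by (elim bexE conjE)
    then obtain U P l where U: "open U" "C \<in> U" "framed_patch (c \<inter> U) P l"
      "\<forall>C'\<in>c \<inter> U. L C' = vec.span {l C'}" and r: "reflects (P C) (l C) (B - C) (A - C)"
      by (elim exE conjE)
    have "P C \<odot> l C \<noteq> 0" using C(1) U(2,3) unfolding framed_patch_def by blast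
    from reflects_sym[OF r this] show ?thesis
      by (intro bexI[OF _ C(1)] conjI exI[of _ U] exI[of _ P] exI[of _ l] C U)
  qed
qed (fact card a b N1 M1)+

text \<open>
  The derivative of the curvature relation, with \<open>A\<close> fixed and \<open>B\<close> moving in the plane of the
  triangle, is computed with the relation for the exchanged roles of \<open>A\<close> and \<open>B\<close>.
\<close>

lemma no_triangle:
  assumes AB: "A \<in> a" "B \<in> b"
  shows False
proof -
  interpret swap: cone_billiard b a c M N L q m by (rule swapped)
  note nz = nonzero[OF AB]
  obtain J where J: "(N has_derivative (*v) J) (at A)"
    using a AB(1) unfolding framed_patch_def by blast
  obtain K where K: "(M has_derivative (*v) K) (at B)"
    using b AB(2) unfolding framed_patch_def by blast
  define \<mu> where "\<mu> = m * \<beta> A B - 1"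
  define e where "e = B - A"
  define l where "l = q - m *s A"
  define v where "v = e - \<alpha> A B *s l"
  define w where "w = - e - \<beta> A B *s (q - m *s B)"
  have w: "w = \<mu> *s e - \<beta> A B *s l"
    unfolding w_def \<mu>_def l_def e_def by (simp add: vec_eq_iff algebra_simps)
  have Nl: "N A \<odot> l = 1" unfolding l_def by (rule N1[OF AB(1)])
  have Ne: "N A \<odot> e = \<alpha> A B" by (simp add: \<alpha>_def e_def)
  have Nv: "N A \<odot> v = 0" unfolding v_def bdot_simps(6,10) Nl Ne by simp
  have Nw: "N A \<odot> w = \<mu> * \<alpha> A B - \<beta> A B" unfolding w bdot_simps(6,10) Nl Ne by simp
  have Mw: "M B \<odot> w = 0"
    unfolding w_def bdot_diff_scale[of _ "- e"] M1[OF AB(2)] by (simp add: \<beta>_def e_def)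
  define Q where "Q = (J *v v) \<odot> e"
  have Q: "Q * \<beta> A B = (\<alpha> A B)\<^sup>2"
    using curvature_relation[OF AB J] unfolding Q_def v_def e_def l_def .
  have swap_eq: "swap.\<alpha> B A = \<beta> A B" "swap.\<beta> B A = \<alpha> A B"
    by (simp_all only: swap.\<alpha>_def swap.\<beta>_def \<alpha>_def \<beta>_def)
  have R: "(K *v w) \<odot> (A - B) * \<alpha> A B = (\<beta> A B)\<^sup>2"
    using swap.curvature_relation[OF AB(2,1) K] unfolding swap_eq w_def e_def by simp
  \<comment> \<open>The derivative along \<open>v\<close> of the normalization
    \<open>N A \<odot> (q - m *s A) = 1\<close>; the term with \<open>m\<close> drops since
    \<open>v\<close> is tangent.\<close>
  have Jl: "(J *v v) \<odot> l = 0"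
  proof -
    obtain \<gamma> where \<gamma>: "\<gamma> 0 = A" "\<forall>\<^sub>F t in nhds 0. \<gamma> t \<in> a" "has_velocity \<gamma> v"
      using framed_patch_curve[OF a AB(1) Nv] by blast
    have "((\<lambda>t. N (\<gamma> t) \<odot> (q - m *s \<gamma> t)) has_field_derivative
        (J *v v) \<odot> (q - m *s \<gamma> 0) + N (\<gamma> 0) \<odot> (0 - (0 *s \<gamma> 0 + m *s v))) (at 0)"
      by (intro velocity_intros has_velocity_compose[OF J] \<gamma> DERIV_const)
    moreover have "\<forall>\<^sub>F t in nhds 0. N (\<gamma> t) \<odot> (q - m *s \<gamma> t) = 1"
      using \<gamma>(2) by eventually_elim (rule N1)
    then have "((\<lambda>t. N (\<gamma> t) \<odot> (q - m *s \<gamma> t)) has_field_derivative 0) (at 0)"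
      by (rule DERIV_cong_ev[OF refl _ refl, THEN iffD2]) (rule DERIV_const)
    ultimately have "(J *v v) \<odot> (q - m *s \<gamma> 0) + N (\<gamma> 0) \<odot> (0 - (0 *s \<gamma> 0 + m *s v)) = 0"
      by (rule DERIV_unique)
    then show ?thesis unfolding \<gamma>(1) l_def using Nv by (simp del: bdot_simps add: bdot_simps(2,8,10))
  qed
  obtain \<delta> where \<delta>: "\<delta> 0 = B" "\<forall>\<^sub>F t in nhds 0. \<delta> t \<in> b" "has_velocity \<delta> w"
    using framed_patch_curve[OF b AB(2) Mw] by blast
  \<comment> \<open>The curvature relation at \<open>B\<close> evaluates the one term that contains
    \<open>K\<close>.\<close>
  have d\<beta>: "((\<lambda>t. \<beta> A (\<delta> t)) has_field_derivative (\<beta> A B)\<^sup>2 / \<alpha> A B) (at 0)"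
  proof -
    have "((\<lambda>t. M (\<delta> t) \<odot> (A - \<delta> t)) has_field_derivative
        (K *v w) \<odot> (A - \<delta> 0) + M (\<delta> 0) \<odot> (0 - w)) (at 0)"
      by (intro velocity_intros has_velocity_compose[OF K] \<delta>)
    moreover have "(K *v w) \<odot> (A - \<delta> 0) + M (\<delta> 0) \<odot> (0 - w) = (\<beta> A B)\<^sup>2 / \<alpha> A B"
      unfolding \<delta>(1) R[symmetric] using Mw nz by simp
    ultimately show ?thesis unfolding \<beta>_def[symmetric] by simp
  qed
  have d\<alpha>: "((\<lambda>t. \<alpha> A (\<delta> t)) has_field_derivative \<mu> * \<alpha> A B - \<beta> A B) (at 0)"
    using has_velocity_bdot[OF has_velocity_const[of "N A"] has_velocity_diff[OF \<delta>(3) has_velocity_const[of A]]]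
    by (simp del: bdot_simps add: bdot_simps(1) \<alpha>_def[symmetric] Nw)
  \<comment> \<open>In the basis \<open>e\<close>, \<open>l\<close> the vector \<open>w\<close> has
    coefficients \<mu> and -\<beta>. The derivative of \<alpha> cancels the latter, so the
    projection of \<open>B - A\<close> is merely rescaled.\<close>
  have dv: "has_velocity (\<lambda>t. \<delta> t - A - \<alpha> A (\<delta> t) *s l) (\<mu> *s v)"
  proof -
    have "has_velocity (\<lambda>t. \<delta> t - A - \<alpha> A (\<delta> t) *s l)
        (w - 0 - ((\<mu> * \<alpha> A B - \<beta> A B) *s l + \<alpha> A (\<delta> 0) *s 0))"
      by (intro velocity_intros d\<alpha> \<delta>)
    moreover have "w - 0 - ((\<mu> * \<alpha> A B - \<beta> A B) *s l + \<alpha> A (\<delta> 0) *s 0) = \<mu> *s v"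
      unfolding w v_def by (simp add: vec_eq_iff algebra_simps)
    ultimately show ?thesis by simp
  qed
  have "((\<lambda>t. (J *v (\<delta> t - A - \<alpha> A (\<delta> t) *s l)) \<odot> (\<delta> t - A)) has_field_derivative
      (J *v (\<mu> *s v)) \<odot> (\<delta> 0 - A) + (J *v (\<delta> 0 - A - \<alpha> A (\<delta> 0) *s l)) \<odot> (w - 0)) (at 0)"
    by (intro velocity_intros dv \<delta>)
  \<comment> \<open>Each factor contributes \<mu> * Q: the first by the rescaling, the second
    because \<open>w\<close> is \<open>\<mu> *s e\<close> up to a multiple of \<open>l\<close>,
    where the form \<open>J *v v\<close> vanishes. As \<open>A\<close> is fixed, \<open>J\<close> is
    constant.\<close>
  moreover have "(J *v (\<mu> *s v)) \<odot> (\<delta> 0 - A) + (J *v (\<delta> 0 - A - \<alpha> A (\<delta> 0) *s l)) \<odot> (w - 0) = 2 * \<mu> * Q"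
  proof -
    have "(J *v v) \<odot> w = \<mu> * Q" unfolding w bdot_simps(6,10) Jl Q_def by simp
    then show ?thesis
      unfolding \<delta>(1) e_def[symmetric] v_def[symmetric] vec.scale bdot_simps(9) Q_def[symmetric] by simp
  qed
  ultimately have dQ: "((\<lambda>t. (J *v (\<delta> t - A - \<alpha> A (\<delta> t) *s l)) \<odot> (\<delta> t - A)) has_field_derivative 2 * \<mu> * Q) (at 0)"
    by simp
  have d1: "((\<lambda>t. (J *v (\<delta> t - A - \<alpha> A (\<delta> t) *s l)) \<odot> (\<delta> t - A) * \<beta> A (\<delta> t)) has_field_derivative
      2 * \<mu> * Q * \<beta> A B + (\<beta> A B)\<^sup>2 / \<alpha> A B * Q) (at 0)"
    using DERIV_mult[OF dQ d\<beta>] unfolding \<delta>(1) e_def[symmetric] v_def[symmetric] Q_def[symmetric] .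
  have d2: "((\<lambda>t. (\<alpha> A (\<delta> t))\<^sup>2) has_field_derivative 2 * \<alpha> A B * (\<mu> * \<alpha> A B - \<beta> A B)) (at 0)"
    using DERIV_power[OF d\<alpha>, of 2] by (simp add: \<delta>(1) mult_ac)
  have ev: "\<forall>\<^sub>F t in nhds 0. (J *v (\<delta> t - A - \<alpha> A (\<delta> t) *s l)) \<odot> (\<delta> t - A) * \<beta> A (\<delta> t) = (\<alpha> A (\<delta> t))\<^sup>2"
    using \<delta>(2) unfolding l_def by eventually_elim (rule curvature_relation[OF AB(1) _ J])
  have e1: "2 * \<mu> * Q * \<beta> A B = 2 * \<mu> * (\<alpha> A B)\<^sup>2" using Q by (simp add: mult.assoc)
  have e2: "(\<beta> A B)\<^sup>2 / \<alpha> A B * Q = \<alpha> A B * \<beta> A B"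
    using Q nz by (simp add: power2_eq_square field_simps)
  have "2 * \<mu> * (\<alpha> A B)\<^sup>2 + \<alpha> A B * \<beta> A B = 2 * \<alpha> A B * (\<mu> * \<alpha> A B - \<beta> A B)"
    unfolding e1[symmetric] e2[symmetric]
    by (rule DERIV_unique[OF d1 DERIV_cong_ev[OF refl ev refl, THEN iffD2, OF d2]])
  then have "3 * (\<alpha> A B * \<beta> A B) = 0" by (simp add: algebra_simps power2_eq_square)
  then show False using nz by simp
qed

end

subsection \<open>Symmetric lines as reflections\<close>

lemma reflects_scale:
  assumes "reflects N l x y" "d \<noteq> 0" "c1 \<noteq> 0" "c2 \<noteq> 0" "c3 \<noteq> 0"
  shows "reflects (d *s N) (c1 *s l) (c2 *s x) (c3 *s y)"
proof -
  obtain k where k: "N \<odot> x \<noteq> 0" "k \<noteq> 0" "y = k *s (x - (2 * (N \<odot> x) / (N \<odot> l)) *s l)"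
    using assms(1) unfolding reflects_def by blast
  have "(2 * ((d *s N) \<odot> (c2 *s x)) / ((d *s N) \<odot> (c1 *s l))) *s (c1 *s l) = c2 *s ((2 * (N \<odot> x) / (N \<odot> l)) *s l)"
    using assms by (simp add: field_simps)
  then have "c3 *s y = (c3 * k / c2) *s (c2 *s x - (2 * ((d *s N) \<odot> (c2 *s x)) / ((d *s N) \<odot> (c1 *s l))) *s (c1 *s l))"
    unfolding k(3) using assms(4) by (simp only: vec.scale_right_diff_distrib[symmetric]) simp
  moreover have "(d *s N) \<odot> (c2 *s x) \<noteq> 0" "c3 * k / c2 \<noteq> 0"
    using assms k(1,2) by simp_all
  ultimately show ?thesis unfolding reflects_def by blast
qed

text \<open>If both lines equal \<open>L\<close>, the reflection is multiplication by -1; both being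
  the tangent line is excluded by \<open>N \<odot> x \<noteq> 0\<close>. In the harmonic case the
  cross-ratio becomes a relation between the 2 by 2 determinants of coordinates, which are also the
  coefficients of \<open>X3\<close> and \<open>X4\<close> in terms of \<open>X1\<close> and
  \<open>X2\<close>.\<close>

lemma symmetric_lines_reflects:
  fixes N l x y :: "'k::real_normed_field ^ 'n::finite"
  assumes sym: "symmetric_lines (vec.span {l}) {v. N \<odot> v = 0} (vec.span {x}) (vec.span {y})"
    and nz: "N \<odot> l \<noteq> 0" "N \<odot> x \<noteq> 0" "y \<noteq> 0"
  shows "reflects N l x y"
proof -
  obtain P where P: "(vec.span {x} = vec.span {l} \<and> vec.span {y} = vec.span {l}) \<or>
      (vec.span {x} = P \<inter> {v. N \<odot> v = 0} \<and> vec.span {y} = P \<inter> {v. N \<odot> v = 0}) \<or>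
      has_cross_ratio (vec.span {l}) (P \<inter> {v. N \<odot> v = 0}) (vec.span {x}) (vec.span {y}) (- 1)"
    using sym unfolding symmetric_lines_def Let_def by blast
  have self: "z \<in> vec.span {z}" for z :: "'k ^ 'n" by (simp add: vec.span_base)
  from P show ?thesis
  proof (elim disjE conjE)
    assume e: "vec.span {x} = vec.span {l}" "vec.span {y} = vec.span {l}"
    obtain c c' where c: "x = c *s l" "y = c' *s l"
      using self[of x] self[of y] unfolding e unfolding vec.span_singleton by blast
    have nz': "c \<noteq> 0" "c' \<noteq> 0" using nz c by auto
    have "y = (- c' / c) *s (x - (2 * (N \<odot> x) / (N \<odot> l)) *s l)"
      unfolding c using nz nz' by (simp add: vec_eq_iff)
    moreover have "- c' / c \<noteq> 0" using nz' by simp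
    ultimately show ?thesis using nz(2) unfolding reflects_def by blast
  next
    assume "vec.span {x} = P \<inter> {v. N \<odot> v = 0}"
    then show ?thesis using self[of x] nz(2) by blast
  next
    assume "has_cross_ratio (vec.span {l}) (P \<inter> {v. N \<odot> v = 0}) (vec.span {x}) (vec.span {y}) (- 1)"
    then obtain e f x1 y1 x2 y2 x3 y3 x4 y4 where
      s: "vec.span {l} = vec.span {x1 *s e + y1 *s f}" "P \<inter> {v. N \<odot> v = 0} = vec.span {x2 *s e + y2 *s f}"
        "vec.span {x} = vec.span {x3 *s e + y3 *s f}" "vec.span {y} = vec.span {x4 *s e + y4 *s f}"
      and r: "- 1 = ((x1 * y3 - x3 * y1) * (x2 * y4 - x4 * y2)) / ((x2 * y3 - x3 * y2) * (x1 * y4 - x4 * y1))"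
      unfolding has_cross_ratio_def by auto
    define X1 where "X1 = x1 *s e + y1 *s f"
    define X2 where "X2 = x2 *s e + y2 *s f"
    define X3 where "X3 = x3 *s e + y3 *s f"
    define X4 where "X4 = x4 *s e + y4 *s f"
    note X = X1_def X2_def X3_def X4_def
    note s = s[folded X]
    define a12 where "a12 = x1 * y2 - x2 * y1"
    define a13 where "a13 = x1 * y3 - x3 * y1"
    define a14 where "a14 = x1 * y4 - x4 * y1"
    define a23 where "a23 = x2 * y3 - x3 * y2"
    define a24 where "a24 = x2 * y4 - x4 * y2"
    have r': "- 1 = (a13 * a24) / (a23 * a14)" using r unfolding a13_def a24_def a23_def a14_def .
    \<comment> \<open>Division by zero yields zero, so the value -1 forces numerator and denominator
      to be nonzero.\<close>
    then have d: "a23 \<noteq> 0" "a14 \<noteq> 0" "a13 \<noteq> 0" by auto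
    with r' have rel: "a13 * a24 = - (a23 * a14)" by (simp add: field_simps)
    have "X2 \<in> P \<inter> {v. N \<odot> v = 0}" unfolding s(2) by (rule self)
    then have N2: "N \<odot> X2 = 0" by simp
    obtain c1 where c1: "l = c1 *s X1" using self[of l] unfolding s(1) unfolding vec.span_singleton by blast
    obtain c3 where c3: "x = c3 *s X3" using self[of x] unfolding s(3) unfolding vec.span_singleton by blast
    obtain c4 where c4: "y = c4 *s X4" using self[of y] unfolding s(4) unfolding vec.span_singleton by blast
    have c: "c1 \<noteq> 0" "c3 \<noteq> 0" "c4 \<noteq> 0" "N \<odot> X1 \<noteq> 0" "N \<odot> X3 \<noteq> 0" using nz c1 c3 c4 by auto
    have e3: "a12 *s X3 = (- a23) *s X1 + a13 *s X2"
      unfolding X a12_def a13_def a23_def by (simp add: vec_eq_iff algebra_simps)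
    have e4: "a12 *s X4 = (- a24) *s X1 + a14 *s X2"
      unfolding X a12_def a14_def a24_def by (simp add: vec_eq_iff algebra_simps)
    have N3: "a12 * (N \<odot> X3) = - a23 * (N \<odot> X1)"
      using arg_cong[OF e3, of "\<lambda>v. N \<odot> v"] N2 unfolding bdot_simps by simp
    then have a12: "a12 \<noteq> 0" using d c by auto
    define h where "h = 2 * (N \<odot> X3) / (N \<odot> X1)"
    have h: "a12 * h = - 2 * a23"
    proof -
      have "a12 * h = 2 * (a12 * (N \<odot> X3)) / (N \<odot> X1)" by (simp add: h_def)
      then show ?thesis unfolding N3 using c by simp
    qed
    have "(a13 * a12) *s X4 = a13 *s (a12 *s X4)" by simp
    also have "\<dots> = (- (a13 * a24)) *s X1 + (a13 * a14) *s X2"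
      unfolding e4 by (simp add: vec_eq_iff algebra_simps)
    also have "\<dots> = a14 *s ((a12 *s X3) - (a12 * h) *s X1)"
      unfolding rel e3 h by (simp add: vec_eq_iff algebra_simps)
    also have "\<dots> = a12 *s (a14 *s (X3 - h *s X1))"
      by (simp add: vec_eq_iff algebra_simps)
    finally have "a12 *s (a13 *s X4) = a12 *s (a14 *s (X3 - h *s X1))"
      by (simp only: vec.scale_scale mult.commute[of a12])
    then have "a13 *s X4 = a14 *s (X3 - h *s X1)" using a12 by (simp only: vector_mul_lcancel) simp
    then have "(1 / a13) *s (a13 *s X4) = (1 / a13) *s (a14 *s (X3 - h *s X1))" by (simp only:)
    then have "X4 = (a14 / a13) *s (X3 - h *s X1)" using d by (simp only: vec.scale_scale) simp
    then have "reflects N X1 X3 X4"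
      unfolding reflects_def h_def using c d by (intro conjI exI[of _ "a14 / a13"]) auto
    from reflects_scale[OF this _ c(1-3), of 1] show ?thesis
      unfolding c1 c3 c4 by simp
  qed
qed

text \<open>Subtracting the two expressions for the sides at \<open>C\<close> leaves
  \<open>B - A\<close>, a linear relation in which \<open>l\<close> and \<open>r\<close> have
  nonzero coefficients.\<close>

lemma reflects_coplanar:
  fixes A B C :: "'k::field_char_0 ^ 'n::finite"
  assumes "reflects N l (B - A) (C - A)" "N \<odot> l \<noteq> 0" "reflects M r (A - B) (C - B)" "M \<odot> r \<noteq> 0"
  shows "\<exists>s \<kappa>. s \<noteq> 0 \<and> r = s *s (l + \<kappa> *s (B - A))"
proof -
  define x where "x = 2 * (N \<odot> (B - A)) / (N \<odot> l)"
  define y where "y = 2 * (M \<odot> (A - B)) / (M \<odot> r)"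
  obtain k k' where k: "k \<noteq> 0" "C - A = k *s (B - A - x *s l)" "k' \<noteq> 0" "C - B = k' *s (A - B - y *s r)"
    using assms(1,3) unfolding reflects_def x_def y_def by blast
  have xy: "x \<noteq> 0" "y \<noteq> 0" using assms unfolding reflects_def x_def y_def by auto
  have "k *s (B - A - x *s l) - k' *s (A - B - y *s r) = B - A"
    unfolding k(2,4)[symmetric] by simp
  then have "(k' * y) *s r = (k * x) *s l + (1 - k - k') *s (B - A)"
    by (simp add: vec_eq_iff algebra_simps)
  then have "(1 / (k' * y)) *s ((k' * y) *s r) = (1 / (k' * y)) *s ((k * x) *s l + (1 - k - k') *s (B - A))"
    by (simp only:)
  also have "\<dots> = (k * x / (k' * y)) *s (l + ((1 - k - k') / (k * x)) *s (B - A))"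
    using k xy by (simp add: scale_simps diff_divide_distrib)
  finally have "r = (k * x / (k' * y)) *s (l + ((1 - k - k') / (k * x)) *s (B - A))"
    using k xy by simp
  moreover have "k * x / (k' * y) \<noteq> 0" using k xy by simp
  ultimately show ?thesis by blast
qed

subsection \<open>Local description of line-framed hypersurfaces\<close>

lemma linear_eq_matrix:
  fixes D :: "'k::field ^ 'n::finite \<Rightarrow> 'k ^ 'm::finite"
  assumes "\<And>x y. D (x + y) = D x + D y" "\<And>c x. D (c *s x) = c *s D x"
  shows "\<exists>K. D = (*v) K"
proof -
  have "Vector_Spaces.linear (*s) (*s) D"
    by unfold_locales (simp_all add: assms algebra_simps)
  then have "D = (*v) (matrix D)"
    by (simp add: matrix_works fun_eq_iff)
  then show ?thesis by blast
qed

lemma multi_analytic_has_derivative_vec: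
  fixes F :: "'k::{real_normed_field,euclidean_space} ^ 'n::finite \<Rightarrow> 'k ^ 'm::finite"
  assumes "\<And>i. multi_analytic_at (\<lambda>x. F x $ i) p"
  shows "\<exists>K. (F has_derivative (*v) K) (at p)"
proof -
  have "\<exists>G. ((\<lambda>x. F x $ i) has_derivative (\<lambda>h. \<Sum>j\<in>UNIV. G j * h $ j)) (at p)" for i
  proof -
    obtain r G where "r > 0"
      "\<And>x. x \<in> ball p r \<Longrightarrow> ((\<lambda>x. F x $ i) has_derivative (\<lambda>h. \<Sum>j\<in>UNIV. G j x * h $ j)) (at x)"
      using multi_analytic_at_has_derivative[OF assms[of i]] by blast
    from this(2)[of p] this(1) show ?thesis by auto
  qed
  then have "\<forall>i. \<exists>G. ((\<lambda>x. F x $ i) has_derivative (\<lambda>h. \<Sum>j\<in>UNIV. G j * h $ j)) (at p)" ..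
  from choice[OF this] obtain G
    where "\<And>i. ((\<lambda>x. F x $ i) has_derivative (\<lambda>h. \<Sum>j\<in>UNIV. G i j * h $ j)) (at p)"
    by blast
  then have "(F has_derivative (*v) (\<chi> i j. G i j)) (at p)"
    by (intro has_derivative_vecI) (simp add: matrix_vector_mult_def)
  then show ?thesis by blast
qed

text \<open>Near \<open>p\<close> the gradient consists of the coefficients of the derivative, which
  are analytic at \<open>p\<close>, so it can be differentiated once more.\<close>

lemma multi_analytic_gradient:
  fixes f :: "'k::{real_normed_field,euclidean_space} ^ 'n::finite \<Rightarrow> 'k"
  assumes "multi_analytic_at f p"
  shows "(f has_derivative (\<lambda>h. gradient f p \<odot> h)) (at p)"
    and "\<exists>J. (gradient f has_derivative (*v) J) (at p)"
proof -
  obtain r G where r: "r > 0" and G: "\<And>x. x \<in> ball p r \<Longrightarrow> (f has_derivative (\<lambda>h. \<Sum>j\<in>UNIV. G j x * h $ j)) (at x)"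
    and G_an: "\<And>j. multi_analytic_at (G j) p"
    using multi_analytic_at_has_derivative[OF assms] by blast
  have grad: "gradient f x = (\<chi> j. G j x)" if x: "x \<in> ball p r" for x
  proof -
    have "deriv (\<lambda>t. f (x + t *s axis j 1)) 0 = G j x" for j
    proof (rule DERIV_imp_deriv)
      have v: "has_velocity (\<lambda>t. x + t *s axis j 1) (axis j 1)"
        unfolding has_velocity_def by (auto intro!: derivative_eq_intros)
      have "(f has_derivative (\<lambda>h. \<Sum>i\<in>UNIV. G i x * h $ i)) (at (x + 0 *s axis j 1))"
        using G[OF x] by simp
      from has_derivative_compose[OF has_velocity_has_derivative[OF v] this]
      have "((\<lambda>t. f (x + t *s axis j 1)) has_derivative (\<lambda>s. \<Sum>i\<in>UNIV. G i x * (s *s axis j 1) $ i)) (at 0)" .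
      moreover have "(\<Sum>i\<in>UNIV. G i x * (s *s axis j 1) $ i) = G j x * s" for s
        by (simp add: axis_def if_distrib mult.commute cong: if_cong)
      ultimately show "((\<lambda>t. f (x + t *s axis j 1)) has_field_derivative G j x) (at 0)"
        by (simp add: has_field_derivative_def)
    qed
    then show ?thesis by (simp add: gradient_def vec_eq_iff)
  qed
  show "(f has_derivative (\<lambda>h. gradient f p \<odot> h)) (at p)"
    using G[of p] grad[of p] r by (simp add: bdot_def)
  have "\<exists>J. ((\<lambda>x. \<chi> j. G j x) has_derivative (*v) J) (at p)"
    by (rule multi_analytic_has_derivative_vec) (simp add: G_an)
  then obtain J where "((\<lambda>x. \<chi> j. G j x) has_derivative (*v) J) (at p)" by blast
  then have "(gradient f has_derivative (*v) J) (at p)"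
    by (rule has_derivative_transform_within_open[of _ _ _ _ "ball p r"]) (use r grad in auto)
  then show "\<exists>J. (gradient f has_derivative (*v) J) (at p)" by blast
qed

text \<open>The conormal is the gradient of a local equation, the frame comes from the analytic
  inverse of the projection. Tangent vectors lie in the kernel of the gradient by the chain rule.
  The converse needs no construction of curves: by transversality every vector is tangent up to a
  multiple of \<open>l B\<close>, so the gradient is nonzero on \<open>l B\<close>, and a vector of
  the kernel has no such component.\<close>

lemma line_framed_patch:
  fixes \<alpha> :: "('k::{real_normed_field,euclidean_space}, 'd::finite) framed_point set"
  assumes lf: "line_framed_hypersurface \<alpha>" and p: "(A, L) \<in> \<alpha>"
  shows "\<exists>U N l. open U \<and> A \<in> U \<and> framed_patch (fst ` \<alpha> \<inter> U) N l \<and>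
     (\<forall>B\<in>fst ` \<alpha> \<inter> U. the_inv_into \<alpha> fst B = (B, vec.span {l B}) \<and> (B, vec.span {l B}) \<in> \<alpha>) \<and>
     (\<forall>W. openin PT_topology W \<longrightarrow> (A, L) \<in> W \<longrightarrow>
        (\<exists>V. open V \<and> A \<in> V \<and> (\<forall>B\<in>fst ` \<alpha> \<inter> V. the_inv_into \<alpha> fst B \<in> W)))"
proof -
  define a where "a = fst ` \<alpha>"
  have Aa: "A \<in> a" using p unfolding a_def by force
  have inj: "inj_on fst \<alpha>" and sub: "embedded_submanifold (CARD('d) - 1) a"
    and an: "analytic_map_into_PT a (the_inv_into \<alpha> fst)"
    and trans0: "\<forall>(B, M)\<in>\<alpha>. {u + v | u v. u \<in> M \<and> v \<in> tangent_space a B} = UNIV"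
    using lf unfolding line_framed_hypersurface_def a_def by blast+
  have trans: "{u + v | u v. u \<in> M \<and> v \<in> tangent_space a B} = UNIV" if "(B, M) \<in> \<alpha>" for B M
    using bspec[OF trans0 that] unfolding prod.case .
  have inv: "the_inv_into \<alpha> fst B \<in> \<alpha>" "fst (the_inv_into \<alpha> fst B) = B" if "B \<in> a" for B
    using that the_inv_into_into[OF inj _ subset_refl] f_the_inv_into_f[OF inj] unfolding a_def by auto
  have codim: "CARD('d) - (CARD('d) - 1) = 1" using zero_less_card_finite[where 'a = 'd] by linarith
  from bspec[OF sub[unfolded embedded_submanifold_def Let_def codim] Aa]
  obtain U F where U: "open U" "A \<in> U" "\<forall>i<1. multi_analytic_on (F i) U" "independent_gradients 1 F A"
    "a \<inter> U = {x \<in> U. \<forall>i<(1::nat). F i x = 0}"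
    by (elim exE conjE)
  define f where "f = F 0"
  obtain U' g where U': "open U'" "A \<in> U'" "\<And>i. multi_analytic_on (\<lambda>x. g x $ i) U'"
    "\<And>x. x \<in> U' \<Longrightarrow> direction_part (g x) \<noteq> 0" "\<And>x. x \<in> a \<inter> U' \<Longrightarrow> the_inv_into \<alpha> fst x = to_PT (g x)"
    using bspec[OF an[unfolded analytic_map_into_PT_def] Aa] by (elim exE conjE) blast
  define l where "l x = direction_part (g x)" for x
  have inv_eq: "the_inv_into \<alpha> fst B = (B, vec.span {l B})" if "B \<in> a \<inter> U'" for B
    using U'(5)[OF that] inv(2)[of B] that unfolding to_PT_def l_def by auto
  have gA: "gradient f A \<noteq> 0"
    using U(4)[unfolded independent_gradients_def, THEN spec, of "\<lambda>_. 1"] unfolding f_def by auto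
  have fan: "multi_analytic_at f x" if "x \<in> U" for x
    using U(3) that unfolding multi_analytic_on_def f_def by blast
  obtain J where "(gradient f has_derivative (*v) J) (at A)"
    using multi_analytic_gradient(2)[OF fan[OF U(2)]] by blast
  then have "gradient f \<midarrow>A\<rightarrow> gradient f A"
    using has_derivative_continuous continuous_at by blast
  then have "\<forall>\<^sub>F x in nhds A. gradient f x \<noteq> 0"
    using gA tendsto_imp_eventually_ne[of "gradient f" "gradient f A" "nhds A" 0]
    by (simp add: tendsto_nhds_iff)
  then obtain U2 where U2: "open U2" "A \<in> U2" "\<And>x. x \<in> U2 \<Longrightarrow> gradient f x \<noteq> 0"
    unfolding eventually_nhds by blast
  define V where "V = U \<inter> U' \<inter> U2"
  have V: "open V" "A \<in> V" using U U' U2 unfolding V_def by auto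
  have "framed_patch (a \<inter> V) (gradient f) l"
    unfolding framed_patch_def
  proof
    fix B assume B: "B \<in> a \<inter> V"
    have BL: "(B, vec.span {l B}) \<in> \<alpha>" using inv(1)[of B] inv_eq[of B] B unfolding V_def by (metis IntD1 IntD2 IntI)
    have T_sub: "gradient f B \<odot> v = 0" if "v \<in> tangent_space a B" for v
    proof -
      have "v \<in> tangent_space (a \<inter> U) B"
        using that B tangent_space_Int_open[OF U(1)] unfolding V_def by auto
      then obtain \<gamma> where \<gamma>: "\<gamma> 0 = B" "\<forall>\<^sub>F t in nhds 0. \<gamma> t \<in> a \<inter> U" "has_velocity \<gamma> v"
        unfolding tangent_space_eq_velocities by blast
      have "\<forall>\<^sub>F t in nhds 0. f (\<gamma> t) = 0"
        using \<gamma>(2) by eventually_elim (use U(5) in \<open>auto simp: f_def\<close>)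
      from DERIV_cong_ev[OF refl this refl, THEN iffD2, OF DERIV_const]
      have "((\<lambda>t. f (\<gamma> t)) has_field_derivative 0) (at 0)" .
      moreover have "(f has_derivative (\<lambda>h. gradient f B \<odot> h)) (at (\<gamma> 0))"
        using multi_analytic_gradient(1)[OF fan[of B]] B \<gamma>(1) unfolding V_def by auto
      from has_derivative_compose[OF has_velocity_has_derivative[OF \<gamma>(3)] this]
      have "((\<lambda>t. f (\<gamma> t)) has_derivative (\<lambda>s. gradient f B \<odot> (s *s v))) (at 0)" .
      then have "((\<lambda>t. f (\<gamma> t)) has_field_derivative gradient f B \<odot> v) (at 0)"
        unfolding has_field_derivative_def
        by (rule has_derivative_eq_rhs) (simp add: fun_eq_iff mult.commute)
      ultimately show ?thesis using DERIV_unique by blast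
    qed
    have decomp: "\<exists>c w. u = c *s l B + w \<and> w \<in> tangent_space a B" for u
    proof -
      have "u \<in> {u + v | u v. u \<in> vec.span {l B} \<and> v \<in> tangent_space a B}"
        unfolding trans[OF BL] by simp
      then show ?thesis unfolding vec.span_singleton by blast
    qed
    have Nl: "gradient f B \<odot> l B \<noteq> 0"
    proof
      assume "gradient f B \<odot> l B = 0"
      then have "gradient f B \<odot> u = 0" for u
        using decomp[of u] T_sub by auto
      then have "gradient f B $ i = 0" for i
        by (metis bdot_axis)
      then have "gradient f B = 0" by (simp add: vec_eq_iff)
      with U2(3) B show False unfolding V_def by auto
    qed
    have "tangent_space a B = {v. gradient f B \<odot> v = 0}"
    proof (intro equalityI subsetI)
      fix v assume v: "v \<in> {v. gradient f B \<odot> v = 0}"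
      obtain c w where cw: "v = c *s l B + w" "w \<in> tangent_space a B" using decomp by blast
      have "c * (gradient f B \<odot> l B) = 0" using v T_sub[OF cw(2)] unfolding cw(1) by simp
      then show "v \<in> tangent_space a B" using Nl cw by simp
    qed (use T_sub in auto)
    then have "tangent_space (a \<inter> V) B = {v. gradient f B \<odot> v = 0}"
      using tangent_space_Int_open[OF V(1)] B by auto
    moreover have "\<exists>J. (gradient f has_derivative (*v) J) (at B)"
      using multi_analytic_gradient(2)[OF fan[of B]] B unfolding V_def by auto
    moreover have "\<exists>K. (l has_derivative (*v) K) (at B)"
      using U'(3) B unfolding V_def multi_analytic_on_def l_def direction_part_def
      by (intro multi_analytic_has_derivative_vec) auto
    ultimately show "tangent_space (a \<inter> V) B = {v. gradient f B \<odot> v = 0} \<and> gradient f B \<odot> l B \<noteq> 0 \<and>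
      (\<exists>J. (gradient f has_derivative (*v) J) (at B)) \<and> (\<exists>K. (l has_derivative (*v) K) (at B))"
      using Nl by blast
  qed
  moreover have "the_inv_into \<alpha> fst B = (B, vec.span {l B}) \<and> (B, vec.span {l B}) \<in> \<alpha>" if "B \<in> a \<inter> V" for B
    using inv_eq[of B] inv(1)[of B] that unfolding V_def by (metis IntD1 IntD2 IntI)
  moreover have "\<exists>V. open V \<and> A \<in> V \<and> (\<forall>B\<in>a \<inter> V. the_inv_into \<alpha> fst B \<in> W)"
    if W: "openin PT_topology W" "(A, L) \<in> W" for W
  proof -
    have "the_inv_into \<alpha> fst A = (A, L)" using the_inv_into_f_f[OF inj p] by simp
    then have "to_PT (g A) \<in> W" using U'(5)[of A] Aa U'(2) W(2) by simp
    then have gW: "g A \<in> PT_lift W" unfolding PT_lift_def using U'(2,4) by simp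
    have oW: "open (PT_lift W)" using W(1) by (simp add: openin_PT_topology)
    obtain K where "(g has_derivative (*v) K) (at A)"
      using U'(2,3) multi_analytic_has_derivative_vec[of g A] unfolding multi_analytic_on_def by blast
    then have "g \<midarrow>A\<rightarrow> g A" using has_derivative_continuous continuous_at by blast
    then have "(g \<longlongrightarrow> g A) (nhds A)" by (simp add: tendsto_nhds_iff)
    from topological_tendstoD[OF this oW gW] have "\<forall>\<^sub>F x in nhds A. g x \<in> PT_lift W" .
    then obtain V' where V': "open V'" "A \<in> V'" "\<And>x. x \<in> V' \<Longrightarrow> g x \<in> PT_lift W"
      unfolding eventually_nhds by blast
    have "the_inv_into \<alpha> fst B \<in> W" if "B \<in> a \<inter> (V' \<inter> U')" for B
      using V'(3)[of B] U'(5)[of B] that unfolding PT_lift_def by auto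
    then show ?thesis using V' U' by (intro exI[of _ "V' \<inter> U'"]) auto
  qed
  ultimately show ?thesis
    using V unfolding a_def[symmetric] by blast
qed

text \<open>Rescaling a conormal keeps its kernel. The work lies in checking that the quotient rule
  yields a derivative that is linear over \<open>'k\<close>, not only over the reals.\<close>

lemma framed_patch_normalize:
  fixes a :: "('k::real_normed_field ^ 'n::finite) set"
  assumes a: "framed_patch a N l" and l: "\<And>A. A \<in> a \<Longrightarrow> \<exists>s. s \<noteq> 0 \<and> l A = s *s (q - m *s A)"
  defines "N' \<equiv> \<lambda>A. (1 / (N A \<odot> (q - m *s A))) *s N A"
  shows "framed_patch a N' (\<lambda>A. q - m *s A)" and "A \<in> a \<Longrightarrow> N' A \<odot> (q - m *s A) = 1"
proof -
  have nz: "N A \<odot> (q - m *s A) \<noteq> 0" if A: "A \<in> a" for A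
  proof -
    obtain s where "l A = s *s (q - m *s A)" using l[OF A] by blast
    moreover have "N A \<odot> l A \<noteq> 0" using a A unfolding framed_patch_def by blast
    ultimately show ?thesis by (metis bdot_simps(10) mult_zero_right)
  qed
  show N'1: "A \<in> a \<Longrightarrow> N' A \<odot> (q - m *s A) = 1" for A
    unfolding N'_def bdot_simps(9) using nz by simp
  have comp: "((\<lambda>x::'k ^ 'n. x $ i) has_derivative (\<lambda>h. h $ i)) (at A)" for i A
    by (rule bounded_linear_imp_has_derivative[OF bounded_linear_vec_nth])
  have frame: "((\<lambda>A. q - m *s A) has_derivative (\<lambda>h. - (m *s h))) (at A)" for A
    by (rule has_derivative_vecI) (auto intro!: derivative_eq_intros comp)
  show "framed_patch a N' (\<lambda>A. q - m *s A)"
    unfolding framed_patch_def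
  proof (intro ballI conjI)
    fix A assume A: "A \<in> a"
    have "tangent_space a A = {v. N A \<odot> v = 0}" using a A unfolding framed_patch_def by blast
    then show "tangent_space a A = {v. N' A \<odot> v = 0}"
      unfolding N'_def bdot_simps(9) using nz[OF A] by simp
    show "N' A \<odot> (q - m *s A) \<noteq> 0" unfolding N'1[OF A] by simp
    have "\<exists>K. (\<lambda>h. - (m *s h) :: 'k ^ 'n) = (*v) K"
      by (rule linear_eq_matrix) (simp_all add: vec_eq_iff algebra_simps)
    then show "\<exists>K. ((\<lambda>A. q - m *s A) has_derivative (*v) K) (at A)" using frame[of A] by metis
    obtain J where J: "(N has_derivative (*v) J) (at A)" using a A unfolding framed_patch_def by blast
    have Jc: "((\<lambda>x. N x $ i) has_derivative (\<lambda>h. (J *v h) $ i)) (at A)" for i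
      by (rule bounded_linear.has_derivative[OF bounded_linear_vec_nth J])
    define g where "g x = N x \<odot> (q - m *s x)" for x
    define g' where "g' h = (J *v h) \<odot> (q - m *s A) - m * (N A \<odot> h)" for h
    have "((\<lambda>x. \<Sum>i\<in>UNIV. N x $ i * (q - m *s x) $ i) has_derivative
       (\<lambda>h. \<Sum>i\<in>UNIV. N A $ i * (- (m *s h)) $ i + (J *v h) $ i * (q - m *s A) $ i)) (at A)"
      by (intro has_derivative_sum has_derivative_mult Jc bounded_linear.has_derivative[OF bounded_linear_vec_nth frame])
    moreover have "(\<Sum>i\<in>UNIV. N A $ i * (- (m *s h)) $ i + (J *v h) $ i * (q - m *s A) $ i) = g' h" for h
      unfolding sum.distrib bdot_def[symmetric] g'_def bdot_simps(8,10) by simp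
    ultimately have g: "(g has_derivative g') (at A)"
      unfolding g_def[abs_def] bdot_def by simp
    have gA: "g A \<noteq> 0" using nz[OF A] by (simp add: g_def)
    define D where "D h = (1 / g A) *s (J *v h) - (g' h / (g A)\<^sup>2) *s N A" for h
    have "(N' has_derivative D) (at A)"
    proof (rule has_derivative_vecI)
      fix i
      have "((\<lambda>x. N x $ i / g x) has_derivative (\<lambda>h. ((J *v h) $ i * g A - N A $ i * g' h) / (g A * g A))) (at A)"
        by (rule has_derivative_divide'[OF Jc g gA])
      moreover have "(\<lambda>x. N' x $ i) = (\<lambda>x. N x $ i / g x)"
        by (simp add: N'_def g_def)
      moreover have "D h $ i = ((J *v h) $ i * g A - N A $ i * g' h) / (g A * g A)" for h
        using gA by (simp add: D_def field_simps power2_eq_square)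
      ultimately show "((\<lambda>x. N' x $ i) has_derivative (\<lambda>h. D h $ i)) (at A)" by simp
    qed
    moreover have "\<exists>K. D = (*v) K"
    proof (rule linear_eq_matrix)
      show "D (x + y) = D x + D y" for x y
        by (simp add: D_def g'_def matrix_vector_right_distrib vec_eq_iff add_divide_distrib diff_divide_distrib algebra_simps)
      show "D (r *s x) = r *s D x" for r x
        by (simp add: D_def g'_def vec.scale vec_eq_iff diff_divide_distrib algebra_simps)
    qed
    ultimately show "\<exists>J. (N' has_derivative (*v) J) (at A)" by metis
  qed
qed

text \<open>Each triple lists a vertex, its successor and its predecessor modulo 3.\<close>

lemma periodic_orbit_3:
  "periodic_orbit 3 \<alpha> q \<longleftrightarrow>
     (\<forall>j<3. q j \<in> \<alpha> j) \<and>
     (\<forall>(i, j, k)\<in>{(0, 1, 2), (1, 2, 0), (2, 0, 1)}.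
        fst (q i) \<noteq> fst (q k) \<and> fst (q i) \<noteq> fst (q j) \<and>
        fst (q i) - fst (q k) \<notin> tangent_space (fst ` \<alpha> i) (fst (q i)) \<and>
        fst (q j) - fst (q i) \<notin> tangent_space (fst ` \<alpha> i) (fst (q i)) \<and>
        symmetric_lines (snd (q i)) (tangent_space (fst ` \<alpha> i) (fst (q i)))
          (vec.span {fst (q i) - fst (q k)}) (vec.span {fst (q j) - fst (q i)}))"
proof -
  have all3: "(\<forall>j<3. Q j) \<longleftrightarrow> Q 0 \<and> Q 1 \<and> Q 2" for Q :: "nat \<Rightarrow> bool"
    by (auto simp: less_Suc_eq numeral_3_eq_3 numeral_2_eq_2)
  show ?thesis
    unfolding periodic_orbit_def all3 Let_def by (simp add: numeral_2_eq_2) blast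
qed

text \<open>The first two mirrors are shrunk until all pairs on them extend to orbits and their
  lines are concurrent. The third is kept whole, with a frame chosen around each
  \<open>C\<close>.\<close>

lemma no_3_reflective_billiard:
  fixes \<alpha> :: "nat \<Rightarrow> ('k::{real_normed_field,euclidean_space}, 'd::finite) framed_point set"
  assumes card: "CARD('d) \<ge> 3" and lpb: "local_projective_billiard 3 \<alpha> p" and refl: "k_reflective 3 \<alpha> p"
  shows False
proof -
  have lf: "line_framed_hypersurface (\<alpha> j)" and pj: "p j \<in> \<alpha> j" if "j < 3" for j
    using lpb that unfolding local_projective_billiard_def by auto
  \<comment> \<open>\<open>s j\<close> recovers the line over a point of the boundary;
    \<open>s 2\<close> provides the line field \<open>L\<close> of the locale.\<close>
  define s where "s j = the_inv_into (\<alpha> j) fst" for j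
  have patch: "\<exists>U N l. open U \<and> fst x \<in> U \<and> framed_patch (fst ` \<alpha> j \<inter> U) N l \<and>
     (\<forall>B\<in>fst ` \<alpha> j \<inter> U. s j B = (B, vec.span {l B}) \<and> (B, vec.span {l B}) \<in> \<alpha> j) \<and>
     (\<forall>W. openin PT_topology W \<longrightarrow> x \<in> W \<longrightarrow>
        (\<exists>V. open V \<and> fst x \<in> V \<and> (\<forall>B\<in>fst ` \<alpha> j \<inter> V. s j B \<in> W)))" if "j < 3" "x \<in> \<alpha> j" for j x
    using line_framed_patch[OF lf[OF that(1)], of "fst x" "snd x"] that(2) unfolding s_def by simp
  have s_eq: "s j (fst x) = x" if "j < 3" "x \<in> \<alpha> j" for j x
    using lf[OF that(1)] the_inv_into_f_f[OF _ that(2)] unfolding line_framed_hypersurface_def s_def by blast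
  have "p j \<in> topspace PT_topology" if j: "j < 3" for j
  proof -
    have "embedded_submanifold_PT (CARD('d) - 1) (\<alpha> j)"
      using lf[OF that] unfolding line_framed_hypersurface_def by blast
    then obtain W where "openin PT_topology W" "p j \<in> W"
      using pj[OF j] unfolding embedded_submanifold_PT_def Let_def by blast
    then show ?thesis using openin_subset by blast
  qed
  then obtain W0 W1 where W0: "openin PT_topology W0" "p 0 \<in> W0" and W1: "openin PT_topology W1" "p 1 \<in> W1"
    and ex: "\<And>q0 q1. q0 \<in> \<alpha> 0 \<inter> W0 \<Longrightarrow> q1 \<in> \<alpha> 1 \<inter> W1 \<Longrightarrow> \<exists>q. periodic_orbit 3 \<alpha> q \<and> q 0 = q0 \<and> q 1 = q1"
    using refl[unfolded k_reflective_def, THEN conjunct2, THEN spec, of "\<lambda>_. topspace PT_topology"]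
    by (metis (no_types, lifting) openin_topspace)
  have lt3: "(0::nat) < 3" "(1::nat) < 3" "(2::nat) < 3" by simp_all
  from patch[OF lt3(1) pj[OF lt3(1)]]
  obtain U N l where U: "open U" "fst (p 0) \<in> U" "framed_patch (fst ` \<alpha> 0 \<inter> U) N l"
    and sU: "\<forall>B\<in>fst ` \<alpha> 0 \<inter> U. s 0 B = (B, vec.span {l B}) \<and> (B, vec.span {l B}) \<in> \<alpha> 0"
    and nU: "\<forall>W. openin PT_topology W \<longrightarrow> p 0 \<in> W \<longrightarrow>
      (\<exists>V. open V \<and> fst (p 0) \<in> V \<and> (\<forall>B\<in>fst ` \<alpha> 0 \<inter> V. s 0 B \<in> W))"
    by (elim exE conjE)
  obtain U' where U': "open U'" "fst (p 0) \<in> U'" "\<And>B. B \<in> fst ` \<alpha> 0 \<inter> U' \<Longrightarrow> s 0 B \<in> W0"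
    using nU[rule_format, OF W0] by blast
  from patch[OF lt3(2) pj[OF lt3(2)]]
  obtain V M r where V: "open V" "fst (p 1) \<in> V" "framed_patch (fst ` \<alpha> 1 \<inter> V) M r"
    and sV: "\<forall>B\<in>fst ` \<alpha> 1 \<inter> V. s 1 B = (B, vec.span {r B}) \<and> (B, vec.span {r B}) \<in> \<alpha> 1"
    and nV: "\<forall>W. openin PT_topology W \<longrightarrow> p 1 \<in> W \<longrightarrow>
      (\<exists>V. open V \<and> fst (p 1) \<in> V \<and> (\<forall>B\<in>fst ` \<alpha> 1 \<inter> V. s 1 B \<in> W))"
    by (elim exE conjE)
  obtain V' where V': "open V'" "fst (p 1) \<in> V'" "\<And>B. B \<in> fst ` \<alpha> 1 \<inter> V' \<Longrightarrow> s 1 B \<in> W1"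
    using nV[rule_format, OF W1] by blast
  define a where "a = fst ` \<alpha> 0 \<inter> U \<inter> U'"
  define b where "b = fst ` \<alpha> 1 \<inter> V \<inter> V'"
  define c where "c = fst ` \<alpha> 2"
  have a: "framed_patch a N l" "a \<noteq> {}"
    unfolding a_def using framed_patch_Int_open[OF U(3) U'(1)] U(2) U'(2) pj[of 0] by auto
  have b: "framed_patch b M r" "b \<noteq> {}"
    unfolding b_def using framed_patch_Int_open[OF V(3) V'(1)] V(2) V'(2) pj[of 1] by auto
  have triangle: "\<exists>C\<in>c. reflects (N A) (l A) (B - A) (C - A) \<and> reflects (M B) (r B) (A - B) (C - B) \<and>
      (\<exists>U P l. open U \<and> C \<in> U \<and> framed_patch (c \<inter> U) P l \<and> (\<forall>C'\<in>c \<inter> U. snd (s 2 C') = vec.span {l C'}) \<and>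
        reflects (P C) (l C) (B - C) (A - C))"
    if A: "A \<in> a" and B: "B \<in> b" for A B
  proof -
    have q0: "(A, vec.span {l A}) \<in> \<alpha> 0 \<inter> W0"
      using bspec[OF sU, of A] U'(3)[of A] A unfolding a_def by auto
    have q1: "(B, vec.span {r B}) \<in> \<alpha> 1 \<inter> W1"
      using bspec[OF sV, of B] V'(3)[of B] B unfolding b_def by auto
    obtain q where q: "periodic_orbit 3 \<alpha> q" "q 0 = (A, vec.span {l A})" "q 1 = (B, vec.span {r B})"
      using ex[OF q0 q1] by blast
    define C where "C = fst (q 2)"
    have q2: "q 2 \<in> \<alpha> 2" using q(1) unfolding periodic_orbit_def by simp
    then have C: "C \<in> c" unfolding C_def c_def by blast
    from patch[OF lt3(3) q2]
    obtain Z P h where Z: "open Z" "C \<in> Z" "framed_patch (c \<inter> Z) P h"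
      and sZ: "\<forall>B\<in>c \<inter> Z. s 2 B = (B, vec.span {h B}) \<and> (B, vec.span {h B}) \<in> \<alpha> 2"
      unfolding C_def[symmetric] c_def[symmetric] by (elim exE conjE)
    have L2: "snd (q 2) = vec.span {h C}"
      using s_eq[OF lt3(3) q2] bspec[OF sZ, of C] C Z(2) unfolding C_def[symmetric]
      by (metis IntI snd_conv)
    have T0: "tangent_space (fst ` \<alpha> 0) A = {v. N A \<odot> v = 0}" and N0: "N A \<odot> l A \<noteq> 0"
      using U(1,3) A tangent_space_Int_open[OF U(1), of A "fst ` \<alpha> 0"] unfolding framed_patch_def a_def by auto
    have T1: "tangent_space (fst ` \<alpha> 1) B = {v. M B \<odot> v = 0}" and N1: "M B \<odot> r B \<noteq> 0"
      using V(1,3) B tangent_space_Int_open[OF V(1), of B "fst ` \<alpha> 1"] unfolding framed_patch_def b_def by auto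
    have T2: "tangent_space (fst ` \<alpha> 2) C = {v. P C \<odot> v = 0}" and N2: "P C \<odot> h C \<noteq> 0"
      using Z C tangent_space_Int_open[OF Z(1), of C c] unfolding framed_patch_def c_def by auto
    have orbit: "A \<noteq> C \<and> A \<noteq> B \<and> N A \<odot> (A - C) \<noteq> 0 \<and>
        symmetric_lines (vec.span {l A}) {v. N A \<odot> v = 0} (vec.span {A - C}) (vec.span {B - A})"
      "B \<noteq> A \<and> B \<noteq> C \<and> M B \<odot> (B - A) \<noteq> 0 \<and>
        symmetric_lines (vec.span {r B}) {v. M B \<odot> v = 0} (vec.span {B - A}) (vec.span {C - B})"
      "C \<noteq> B \<and> C \<noteq> A \<and> P C \<odot> (C - B) \<noteq> 0 \<and>
        symmetric_lines (vec.span {h C}) {v. P C \<odot> v = 0} (vec.span {C - B}) (vec.span {A - C})"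
      using q(1) unfolding periodic_orbit_3 by (simp_all del: bdot_simps One_nat_def add: q(2,3) C_def[symmetric] L2 T0 T1 T2)
    \<comment> \<open>The orbit condition relates the incoming side to the outgoing one; a change of
      sign and symmetry turn both into vectors based at the vertex.\<close>
    have "reflects (N A) (l A) (A - C) (B - A)"
      using orbit(1) N0 by (intro symmetric_lines_reflects) auto
    from reflects_scale[OF this, of 1 1 "- 1" 1] have "reflects (N A) (l A) (C - A) (B - A)" by simp
    from reflects_sym[OF this N0] have 1: "reflects (N A) (l A) (B - A) (C - A)" .
    have "reflects (M B) (r B) (B - A) (C - B)"
      using orbit(2) N1 by (intro symmetric_lines_reflects) auto
    from reflects_scale[OF this, of 1 1 "- 1" 1] have 2: "reflects (M B) (r B) (A - B) (C - B)" by simp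
    have "reflects (P C) (h C) (C - B) (A - C)"
      using orbit(3) N2 by (intro symmetric_lines_reflects) auto
    from reflects_scale[OF this, of 1 1 "- 1" 1] have 3: "reflects (P C) (h C) (B - C) (A - C)" by simp
    have "\<forall>C'\<in>c \<inter> Z. snd (s 2 C') = vec.span {h C'}" using sZ by simp
    then show ?thesis
      by (intro bexI[OF _ C] conjI 1 2 exI[of _ Z] exI[of _ P] exI[of _ h] 3 Z)
  qed
  have nt: "M B \<odot> (B - A) \<noteq> 0" if "A \<in> a" "B \<in> b" for A B
  proof -
    have "M B \<odot> (A - B) \<noteq> 0" using triangle[OF that] unfolding reflects_def by blast
    then show ?thesis by auto
  qed
  have frame_nz: "N A \<odot> l A \<noteq> 0" "M B \<odot> r B \<noteq> 0" if "A \<in> a" "B \<in> b" for A B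
    using a(1) b(1) that unfolding framed_patch_def by blast+
  have coplanar: "\<exists>s \<kappa>. s \<noteq> 0 \<and> r B = s *s (l A + \<kappa> *s (B - A))" if AB: "A \<in> a" "B \<in> b" for A B
  proof -
    obtain C where "reflects (N A) (l A) (B - A) (C - A)" "reflects (M B) (r B) (A - B) (C - B)"
      using triangle[OF AB] by (elim bexE conjE)
    from reflects_coplanar[OF this(1) frame_nz(1)[OF AB] this(2) frame_nz(2)[OF AB]] show ?thesis .
  qed
  have "\<exists>q m X Y. open X \<and> open Y \<and> a \<inter> X \<noteq> {} \<and> b \<inter> Y \<noteq> {} \<and>
     (\<forall>A\<in>a \<inter> X. \<exists>s. s \<noteq> 0 \<and> l A = s *s (q - m *s A)) \<and>
     (\<forall>B\<in>b \<inter> Y. \<exists>s. s \<noteq> 0 \<and> r B = s *s (q - m *s B)) \<and>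
     (\<forall>A\<in>a \<inter> X. \<forall>B\<in>b \<inter> Y. lin_indep2 (B - A) (q - m *s A))"
    by (rule concurrent_frames[OF card a b]) (rule nt coplanar; assumption)+
  then obtain q m X Y where XY: "open X" "open Y" "a \<inter> X \<noteq> {}" "b \<inter> Y \<noteq> {}"
    and la: "\<forall>A\<in>a \<inter> X. \<exists>s. s \<noteq> 0 \<and> l A = s *s (q - m *s A)"
    and rb: "\<forall>B\<in>b \<inter> Y. \<exists>s. s \<noteq> 0 \<and> r B = s *s (q - m *s B)"
    and ind: "\<forall>A\<in>a \<inter> X. \<forall>B\<in>b \<inter> Y. lin_indep2 (B - A) (q - m *s A)"
    by (elim exE conjE)
  note na = framed_patch_normalize[OF framed_patch_Int_open[OF a(1) XY(1)] bspec[OF la]]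
  note nb = framed_patch_normalize[OF framed_patch_Int_open[OF b(1) XY(2)] bspec[OF rb]]
  define N' where "N' A = (1 / (N A \<odot> (q - m *s A))) *s N A" for A
  define M' where "M' B = (1 / (M B \<odot> (q - m *s B))) *s M B" for B
  have renorm: "reflects ((1 / (n \<odot> t)) *s n) t x y" if "reflects n (u *s t) x y" "u \<noteq> 0" "n \<odot> t \<noteq> 0" for n t x y u
    using reflects_scale[OF that(1), of "1 / (n \<odot> t)" "1 / u" 1 1] that(2,3) by simp
  have "cone_billiard (a \<inter> X) (b \<inter> Y) c N' M' (\<lambda>C. snd (s 2 C)) q m"
  proof
    show "3 \<le> CARD('d)" by (rule card)
    show "framed_patch (a \<inter> X) N' (\<lambda>A. q - m *s A)" "\<And>A. A \<in> a \<inter> X \<Longrightarrow> N' A \<odot> (q - m *s A) = 1"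
      using na unfolding N'_def[abs_def] by blast+
    show "framed_patch (b \<inter> Y) M' (\<lambda>A. q - m *s A)" "\<And>A. A \<in> b \<inter> Y \<Longrightarrow> M' A \<odot> (q - m *s A) = 1"
      using nb unfolding M'_def[abs_def] by blast+
    show "lin_indep2 (B - A) (q - m *s A)" if "A \<in> a \<inter> X" "B \<in> b \<inter> Y" for A B
      using ind that by blast
    show "\<exists>C\<in>c. reflects (N' A) (q - m *s A) (B - A) (C - A) \<and> reflects (M' B) (q - m *s B) (A - B) (C - B) \<and>
      (\<exists>U P l. open U \<and> C \<in> U \<and> framed_patch (c \<inter> U) P l \<and> (\<forall>C'\<in>c \<inter> U. snd (s 2 C') = vec.span {l C'}) \<and>
        reflects (P C) (l C) (B - C) (A - C))" if A: "A \<in> a \<inter> X" and B: "B \<in> b \<inter> Y" for A B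
    proof -
      have AB: "A \<in> a" "B \<in> b" using A B by auto
      obtain u where u: "u \<noteq> 0" "l A = u *s (q - m *s A)" using bspec[OF la A] by blast
      obtain w where w: "w \<noteq> 0" "r B = w *s (q - m *s B)" using bspec[OF rb B] by blast
      have nz: "N A \<odot> (q - m *s A) \<noteq> 0" "M B \<odot> (q - m *s B) \<noteq> 0"
        using frame_nz[OF AB] unfolding u(2) w(2) by auto
      show ?thesis
        using triangle[OF AB] unfolding u(2) w(2) N'_def M'_def
        by (elim bexE conjE, intro bexI conjI) (rule renorm[OF _ u(1) nz(1)] renorm[OF _ w(1) nz(2)] | assumption)+
    qed
  qed
  then show False
    using cone_billiard.no_triangle XY(3,4) by blast
qed

theorem theorem1p16:
  assumes "CARD('d::finite) \<ge> 3"
  shows "\<not> (\<exists>(\<alpha> :: nat \<Rightarrow> (real, 'd) framed_point set) p.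
             local_projective_billiard 3 \<alpha> p \<and> k_reflective 3 \<alpha> p) \<and>
         \<not> (\<exists>(\<alpha> :: nat \<Rightarrow> (complex, 'd) framed_point set) p.
             local_projective_billiard 3 \<alpha> p \<and> k_reflective 3 \<alpha> p)"
  using no_3_reflective_billiard[OF assms, where 'k = real] no_3_reflective_billiard[OF assms, where 'k = complex]
  by blast

end
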